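(* Let $n\ge 2$ and let $\widetilde{M}_n$ be the size of the greedy independent set of edges on a uniform plane tree $\widetilde{\mathcal{T}}_n$ with $n$ vertices. For $1\le k\le\lfloor n/2\rfloor$, $$\mathbb{P}(\widetilde{M}_n=k)=\frac{n}{k}\,\frac{\binom{n+k-2}{2k-1}\binom{n-k-1}{k-1}}{\binom{2n-2}{n-1}}=\frac{n!\,(n-1)!\,(n+k-2)!}{k!\,(2k-1)!\,(n-2k)!\,(2n-2)!}.$$ As a consequence, for all $A\ge 0$, $$\mathbb{P}\left(\widetilde{M}_n=\left\lfloor\frac{n}{3}+x\sqrt{n}\right\rfloor\right)\underset{n\to+\infty}{\sim}\frac{1}{\sqrt{n}}\,\frac{1}{\sqrt{2\pi(2/9)^2}}\exp\left(-\frac{x^2}{2\cdot(2/9)^2}\right)$$ uniformly for $x\in[-A,A]$.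
   Context: A plane tree is a rooted, ordered, unlabeled finite tree; its size is its number of vertices. $\widetilde{\mathcal{T}}_n$ is uniformly random among plane trees of size $n$. An independent set of edges (matching) is a set of edges no two of which share a vertex. The greedy independent set of edges of a finite tree is the random maximal matching obtained by inspecting the edges one by one in a uniformly random order (chosen, given the tree, uniformly among all orderings of its edges) and keeping an edge if and only if it shares no vertex with a previously kept edge, until all edges are inspected. $\widetilde{M}_n$ is the number of edges kept when this is applied to $\widetilde{\mathcal{T}}_n$. "$\sim$ uniformly for $x\in[-A,A]$" means that the ratio of the two sides tends to $1$ as $n\to\infty$, uniformly in $x\in[-A,A]$. *)

theory Defs
  imports "HOL-Probability.Probability" "HOL-Combinatorics.Multiset_Permutations"
begin

datatype plane_tree = Node "plane_tree list"

text \<open>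
  Vertices are addressed by their Ulam--Harris labels: the root is \<open>[]\<close>, and \<open>v @ [i]\<close> is the
  \<open>i\<close>-th child (counted from 0) of \<open>v\<close>.
\<close>

primrec vertices :: "plane_tree \<Rightarrow> nat list set" where
  "vertices (Node ts) = insert [] (\<Union>i<length ts. (#) i ` (map vertices ts ! i))"

definition edges :: "plane_tree \<Rightarrow> nat list set set" where
  "edges t = {{v, v @ [i]} |v i. v @ [i] \<in> vertices t}"

definition plane_trees :: "nat \<Rightarrow> plane_tree set" where
  "plane_trees n = {t. card (vertices t) = n}"

definition greedy_step :: "'v set \<Rightarrow> 'v set set \<Rightarrow> 'v set set" where
  "greedy_step e M = (if \<forall>f\<in>M. e \<inter> f = {} then insert e M else M)"

definition greedy_matching :: "'v set list \<Rightarrow> 'v set set" where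
  "greedy_matching es = fold greedy_step es {}"

definition random_greedy_matching :: "'v set set \<Rightarrow> 'v set set pmf" where
  "random_greedy_matching E = map_pmf greedy_matching (pmf_of_set (permutations_of_set E))"

text \<open>
  The law of \<open>M\<^sub>n\<close>. The lemmas below show that both uniform distributions involved are
  over finite nonempty sets as soon as \<open>n \<ge> 1\<close>.
\<close>

definition greedy_size_pmf :: "nat \<Rightarrow> nat pmf" where
  "greedy_size_pmf n =
     pmf_of_set (plane_trees n) \<bind> (\<lambda>t. map_pmf card (random_greedy_matching (edges t)))"

lemma finite_vertices: "finite (vertices t)"
  by (induction t) auto

lemma card_vertices_Node: "card (vertices (Node ts)) = Suc (\<Sum>t\<leftarrow>ts. card (vertices t))"
proof -
  have "card (vertices (Node ts)) = Suc (card (\<Union>i<length ts. (#) i ` vertices (ts ! i)))"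
    by (auto intro!: finite_vertices card_insert_disjoint)
  also have "card (\<Union>i<length ts. (#) i ` vertices (ts ! i)) =
               (\<Sum>i<length ts. card ((#) i ` vertices (ts ! i)))"
    by (rule card_UN_disjoint) (auto intro!: finite_vertices)
  also have "\<dots> = (\<Sum>i<length ts. card (vertices (ts ! i)))"
    by (simp add: card_image)
  also have "\<dots> = (\<Sum>t\<leftarrow>ts. card (vertices t))"
    by (simp add: sum_list_sum_nth atLeast0LessThan)
  finally show ?thesis .
qed

lemma finite_edges: "finite (edges t)"
proof (rule finite_subset)
  show "edges t \<subseteq> (\<lambda>w. {butlast w, w}) ` vertices t"
  proof
    fix e assume "e \<in> edges t"
    then obtain v i where vi: "v @ [i] \<in> vertices t" "e = {v, v @ [i]}"
      unfolding edges_def by blast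
    then have "e = {butlast (v @ [i]), v @ [i]}" by simp
    with vi(1) show "e \<in> (\<lambda>w. {butlast w, w}) ` vertices t" by blast
  qed
qed (simp add: finite_vertices)

lemma finite_plane_trees: "finite (plane_trees n)"
proof -
  have pos: "1 \<le> card (vertices t)" for t
    by (cases t) (simp del: vertices.simps add: card_vertices_Node)
  have "finite {t. card (vertices t) \<le> n}"
  proof (induction n)
    case 0
    have "{t. card (vertices t) \<le> 0} = {}"
      using pos by (auto simp: Suc_le_eq)
    then show ?case by (metis finite.emptyI)
  next
    case (Suc n)
    let ?S = "{t. card (vertices t) \<le> n}"
    have "{t. card (vertices t) \<le> Suc n} \<subseteq> Node ` {ts. set ts \<subseteq> ?S \<and> length ts \<le> n}"
    proof
      fix t assume t: "t \<in> {t. card (vertices t) \<le> Suc n}"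
      obtain ts where ts: "t = Node ts" by (cases t)
      from t ts have le: "(\<Sum>t\<leftarrow>ts. card (vertices t)) \<le> n"
        by (simp del: vertices.simps add: card_vertices_Node)
      have "length ts = (\<Sum>t\<leftarrow>ts. 1)" by (induction ts) auto
      also have "\<dots> \<le> (\<Sum>t\<leftarrow>ts. card (vertices t))"
        by (rule sum_list_mono) (rule pos)
      finally have "length ts \<le> n" using le by simp
      moreover have "card (vertices u) \<le> n" if "u \<in> set ts" for u
        using member_le_sum_list[of "card (vertices u)" "map (\<lambda>t. card (vertices t)) ts"] that le
        by force
      ultimately show "t \<in> Node ` {ts. set ts \<subseteq> ?S \<and> length ts \<le> n}"
        using ts by auto
    qed
    then show ?case
      using finite_lists_length_le[OF Suc.IH, of n] by (meson finite_imageI finite_subset)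
  qed
  then show ?thesis
    by (rule rev_finite_subset) (auto simp: plane_trees_def)
qed

lemma plane_trees_nonempty:
  assumes "n \<ge> 1"
  shows "plane_trees n \<noteq> {}"
proof -
  have "card (vertices (Node (replicate (n - 1) (Node [])))) = n"
    using assms by (simp del: vertices.simps add: card_vertices_Node sum_list_replicate)
  then show ?thesis unfolding plane_trees_def by blast
qed

end

theory Submission
  imports Defs "HOL-Real_Asymp.Real_Asymp"
begin

text \<open>
  \<^bold>\<open>Exact law.\<close> Let \<open>G(z)\<close> be the generating function of plane trees by size in which a tree \<open>t\<close> has
  weight \<open>E[y\<^sup>M]\<close>, with \<open>M\<close> the size of the greedy matching of \<open>t\<close>. The first inspected edge is always
  kept, and deleting its two endpoints leaves a forest whose components are again explored
  greedily, independently of each other. The first edge is a uniform edge of \<open>t\<close>, and a uniform plane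
  tree re-rooted at a uniform oriented edge is still uniform; moreover the matching does not see the
  root. On average over all trees of a given size, the first edge may therefore be taken to be the
  edge from the root to its first child. What remains are two ordered forests, one below each
  endpoint, so that
    \<open>G = z + y z\<^sup>2 / (1 - G)\<^sup>2\<close>.
  The re-rooting is made precise by moving the root along its first edge
  (\<open>rotate_root\<close>): iterating this \<open>2 (n - 1)\<close> times is the contour walk around a tree of size \<open>n\<close>,
  which traverses every edge exactly twice (\<open>sum_root_edge_orbit\<close>), and every single move is a
  bijection on the trees of size \<open>n\<close>. This gives \<open>sum_tree_pgf\<close>.

  The equation is of Lagrange type. Instead of inverting it, one computes all powers of
  \<open>S = 1 / (1 - G)\<close> at once: the equation says \<open>S\<^sup>r\<^sup>+\<^sup>1 = S\<^sup>r + z S\<^sup>r\<^sup>+\<^sup>1 + y z\<^sup>2 S\<^sup>r\<^sup>+\<^sup>3\<close>, which determines the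
  coefficients recursively, and the closed form predicted by Lagrange inversion satisfies this
  recursion (\<open>matching_number_rec\<close>). The same device yields the Catalan number of plane
  trees, and comparing coefficients of \<open>y\<^sup>k\<close> gives the law.

  \<^bold>\<open>Local limit.\<close> The logarithm of the explicit probability at \<open>k = n (1/3 + d)\<close> is, by Stirling's formula,
  \<open>n \<cdot> rate d - ln n / 2\<close> plus terms that converge, and \<open>rate d \<sim> - (81/8) d\<^sup>2\<close> as \<open>d \<rightarrow> 0\<close>, where
  \<open>81/8 = 1 / (2 (2/9)\<^sup>2)\<close>. Uniformity on compact sets follows because \<open>x\<close> may vary with \<open>n\<close> in the
  argument (\<open>uniform_limit_sequentiallyI\<close>).
\<close>

unbundle no vec_syntax and fps_syntax

section \<open>The greedy matching of a set of edges\<close>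

definition greedy_size :: "'v set set \<Rightarrow> nat pmf" where
  "greedy_size E = map_pmf card (random_greedy_matching E)"

text \<open>
  The probability generating function is taken at a fixed real \<open>y\<close>, so that all generating functions
  below live over the field of real numbers; coefficients in \<open>y\<close> are compared only when the law itself is read off.
\<close>

definition greedy_pgf :: "real \<Rightarrow> 'v set set \<Rightarrow> real" where
  "greedy_pgf y E = measure_pmf.expectation (greedy_size E) (\<lambda>k. y ^ k)"

text \<open>
  Once \<open>e\<close> has been kept, every edge that meets \<open>e\<close> is rejected, so these edges may as well be
  removed from the list, after which \<open>e\<close> no longer influences any decision.
\<close>

lemma fold_greedy_step_insert:
  "fold greedy_step es (insert e M) = insert e (fold greedy_step (filter (\<lambda>f. f \<inter> e = {}) es) M)"
proof (induction es arbitrary: M)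
  case (Cons f es)
  show ?case
  proof (cases "f \<inter> e = {}")
    case True
    then have "greedy_step f (insert e M) = insert e (greedy_step f M)"
      by (auto simp: greedy_step_def)
    with True Cons.IH show ?thesis by simp
  next
    case False
    then have "greedy_step f (insert e M) = insert e M"
      by (auto simp: greedy_step_def)
    with False Cons.IH show ?thesis by simp
  qed
qed simp

lemma greedy_matching_Cons:
  "greedy_matching (e # es) = insert e (greedy_matching (filter (\<lambda>f. f \<inter> e = {}) es))"
  by (simp add: greedy_matching_def greedy_step_def[of e] fold_greedy_step_insert)

lemma fold_greedy_step_subset: "fold greedy_step es M \<subseteq> M \<union> set es"
proof (induction es arbitrary: M)
  case (Cons e es)
  show ?case using Cons.IH[of "greedy_step e M"] by (auto simp: greedy_step_def split: if_splits)
qed simp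

lemma greedy_matching_subset: "greedy_matching es \<subseteq> set es"
  using fold_greedy_step_subset[of es "{}"] by (simp add: greedy_matching_def)

lemma card_greedy_matching_Cons:
  assumes "e \<noteq> {}"
  shows "card (greedy_matching (e # es)) = Suc (card (greedy_matching (filter (\<lambda>f. f \<inter> e = {}) es)))"
proof -
  have "e \<notin> greedy_matching (filter (\<lambda>f. f \<inter> e = {}) es)"
    using greedy_matching_subset[of "filter (\<lambda>f. f \<inter> e = {}) es"] assms by auto
  moreover have "finite (greedy_matching (filter (\<lambda>f. f \<inter> e = {}) es))"
    by (rule finite_subset[OF greedy_matching_subset]) simp
  ultimately show ?thesis by (simp add: greedy_matching_Cons)
qed

text \<open>
  A uniform ordering of a set induces a uniform ordering of any subset; this is why the process that
  continues after the first kept edge is again a greedy matching.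
\<close>

lemma filter_random_permutation:
  assumes "finite A"
  shows "map_pmf (filter P) (pmf_of_set (permutations_of_set A)) =
           pmf_of_set (permutations_of_set {x \<in> A. P x})"
proof -
  have "map_pmf (filter P) (pmf_of_set (permutations_of_set A)) =
          map_pmf fst (map_pmf (partition P) (pmf_of_set (permutations_of_set A)))"
    by (simp add: pmf.map_comp o_def)
  also have "\<dots> = pmf_of_set (permutations_of_set {x \<in> A. P x})"
    by (simp add: partition_random_permutations[OF assms] map_fst_pair_pmf)
  finally show ?thesis .
qed

text \<open>
  Condition on the first edge of the ordering. No edge is empty, so the edges that avoid the first edge
  \<open>e\<close> do not include \<open>e\<close> itself.
\<close>

lemma greedy_size_rec:
  assumes "finite E" "E \<noteq> {}" "{} \<notin> E"
  shows "greedy_size E = pmf_of_set E \<bind> (\<lambda>e. map_pmf Suc (greedy_size {f \<in> E. f \<inter> e = {}}))"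
proof -
  let ?U = "\<lambda>A. pmf_of_set (permutations_of_set A)"
  have "greedy_size E = pmf_of_set E \<bind> (\<lambda>e. map_pmf (card \<circ> greedy_matching \<circ> (#) e) (?U (E - {e})))"
    unfolding greedy_size_def random_greedy_matching_def
    by (simp add: random_permutation_of_set assms map_bind_pmf pmf.map_comp o_def
        flip: map_pmf_def)
  also have "\<dots> = pmf_of_set E \<bind> (\<lambda>e. map_pmf Suc (greedy_size {f \<in> E. f \<inter> e = {}}))"
  proof (rule bind_pmf_cong[OF refl])
    fix e assume "e \<in> set_pmf (pmf_of_set E)"
    then have e: "e \<in> E" "e \<noteq> {}" using assms by auto
    have "map_pmf (card \<circ> greedy_matching \<circ> (#) e) (?U (E - {e})) =
            map_pmf (Suc \<circ> card \<circ> greedy_matching) (map_pmf (filter (\<lambda>f. f \<inter> e = {})) (?U (E - {e})))"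
      by (simp add: pmf.map_comp o_def card_greedy_matching_Cons[OF e(2)])
    also have "\<dots> = map_pmf (Suc \<circ> card \<circ> greedy_matching) (?U {f \<in> E - {e}. f \<inter> e = {}})"
      by (subst filter_random_permutation) (use assms in simp_all)
    also have "{f \<in> E - {e}. f \<inter> e = {}} = {f \<in> E. f \<inter> e = {}}" using e by auto
    finally show "map_pmf (card \<circ> greedy_matching \<circ> (#) e) (?U (E - {e})) =
        map_pmf Suc (greedy_size {f \<in> E. f \<inter> e = {}})"
      by (simp add: greedy_size_def random_greedy_matching_def pmf.map_comp o_def)
  qed
  finally show ?thesis .
qed

lemma finite_greedy_size: "finite E \<Longrightarrow> finite (set_pmf (greedy_size E))"
  by (simp add: greedy_size_def random_greedy_matching_def)

lemma greedy_pgf_empty: "greedy_pgf y {} = 1"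
  by (simp add: greedy_pgf_def greedy_size_def random_greedy_matching_def greedy_matching_def
      pmf_of_set_singleton)

lemma greedy_pgf_rec:
  assumes "finite E" "{} \<notin> E"
  shows "real (card E) * greedy_pgf y E = y * (\<Sum>e\<in>E. greedy_pgf y {f \<in> E. f \<inter> e = {}})"
proof (cases "E = {}")
  case False
  have "greedy_pgf y E = measure_pmf.expectation (pmf_of_set E)
      (\<lambda>e. measure_pmf.expectation (map_pmf Suc (greedy_size {f \<in> E. f \<inter> e = {}})) (\<lambda>k. y ^ k))"
    unfolding greedy_pgf_def greedy_size_rec[OF assms(1) False assms(2)]
    by (subst pmf_expectation_bind_pmf_of_set)
      (use assms False in \<open>simp_all add: integral_pmf_of_set divide_inverse sum_distrib_left
        finite_greedy_size mult_ac\<close>)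
  also have "\<dots> = (\<Sum>e\<in>E. y * greedy_pgf y {f \<in> E. f \<inter> e = {}}) / card E"
    by (simp add: integral_pmf_of_set assms False greedy_pgf_def flip: sum_distrib_left)
  finally show ?thesis using assms False by (simp add: card_eq_0_iff flip: sum_distrib_left)
qed simp

text \<open>
  Vertex-disjoint edge sets evolve independently. This needs no analysis of interleaved orderings: both
  sides satisfy the recursion \<open>greedy_pgf_rec\<close>, whose first edge lies in one of the two parts and
  leaves the other untouched, so the claim follows by induction on the number of edges.
\<close>

lemma greedy_pgf_Un:
  assumes "finite A" "finite B" "{} \<notin> A" "{} \<notin> B" "\<And>a b. a \<in> A \<Longrightarrow> b \<in> B \<Longrightarrow> a \<inter> b = {}"
  shows "greedy_pgf y (A \<union> B) = greedy_pgf y A * greedy_pgf y B"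
  using assms
proof (induction "card (A \<union> B)" arbitrary: A B rule: less_induct)
  case less
  let ?g = "greedy_pgf y" and ?r = "\<lambda>E e. {f \<in> E. f \<inter> e = {}}"
  show ?case
  proof (cases "A \<union> B = {}")
    case True
    then show ?thesis by (simp add: greedy_pgf_empty)
  next
    case False
    have disj: "A \<inter> B = {}" using less.prems(3,4,5) by fastforce
    have sub: "?r E e \<subset> E" if "e \<in> E" "{} \<notin> E" for E and e :: "'a set"
    proof -
      have "e \<notin> ?r E e" using that by auto
      with that(1) show ?thesis by blast
    qed
    have A: "?g (?r (A \<union> B) e) = ?g (?r A e) * ?g B" if "e \<in> A" for e
    proof -
      have "?r (A \<union> B) e = ?r A e \<union> B" using less.prems(5) that by blast
      moreover have c: "card (?r A e \<union> B) < card (A \<union> B)"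
      proof (rule psubset_card_mono)
        show "finite (A \<union> B)" using less.prems by simp
        show "?r A e \<union> B \<subset> A \<union> B" using sub[OF that less.prems(3)] that disj by blast
      qed
      moreover have "?g (?r A e \<union> B) = ?g (?r A e) * ?g B"
        by (rule less.hyps[OF c]) (use less.prems(1-4) in simp_all, metis less.prems(5))
      ultimately show ?thesis by simp
    qed
    have B: "?g (?r (A \<union> B) e) = ?g A * ?g (?r B e)" if "e \<in> B" for e
    proof -
      have "?r (A \<union> B) e = A \<union> ?r B e" using less.prems(5) that by blast
      moreover have c: "card (A \<union> ?r B e) < card (A \<union> B)"
      proof (rule psubset_card_mono)
        show "finite (A \<union> B)" using less.prems by simp
        show "A \<union> ?r B e \<subset> A \<union> B" using sub[OF that less.prems(4)] that disj by blast
      qed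
      moreover have "?g (A \<union> ?r B e) = ?g A * ?g (?r B e)"
        by (rule less.hyps[OF c]) (use less.prems(1-4) in simp_all, metis less.prems(5))
      ultimately show ?thesis by simp
    qed
    have "real (card (A \<union> B)) * ?g (A \<union> B) = y * (\<Sum>e\<in>A \<union> B. ?g (?r (A \<union> B) e))"
      by (rule greedy_pgf_rec) (use less.prems in auto)
    also have "\<dots> = y * (\<Sum>e\<in>A. ?g (?r A e)) * ?g B + ?g A * (y * (\<Sum>e\<in>B. ?g (?r B e)))"
      by (subst sum.union_disjoint) (use less.prems disj A B in
        \<open>simp_all add: sum_distrib_left sum_distrib_right algebra_simps\<close>)
    also have "\<dots> = real (card (A \<union> B)) * (?g A * ?g B)"
      using less.prems disj
      by (simp add: greedy_pgf_rec[symmetric] card_Un_disjoint algebra_simps)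
    finally show ?thesis using False less.prems(1,2) by (auto simp: card_eq_0_iff)
  qed
qed

section \<open>Moving the root of a tree along its contour\<close>

text \<open>
  Plane trees whose vertices carry names. Naming the vertices has the effect that moving the root does
  not change the edge set at all, whereas with Ulam--Harris labels every vertex would have to be renamed.
\<close>

datatype 'v ltree = LNode 'v "'v ltree list"

primrec lroot :: "'v ltree \<Rightarrow> 'v" where
  "lroot (LNode v ts) = v"

fun lverts :: "'v ltree \<Rightarrow> 'v list" where
  "lverts (LNode v ts) = v # concat (map lverts ts)"

fun ledges :: "'v ltree \<Rightarrow> 'v set list" where
  "ledges (LNode v ts) = concat (map (\<lambda>t. {v, lroot t} # ledges t) ts)"

fun shape :: "'v ltree \<Rightarrow> plane_tree" where
  "shape (LNode v ts) = Node (map shape ts)"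

text \<open>
  One step of the contour walk: the root moves to its first child, and the old root becomes the last
  child of the new one.
\<close>

fun lrotate :: "'v ltree \<Rightarrow> 'v ltree" where
  "lrotate (LNode v (LNode c as # bs)) = LNode c (as @ [LNode v bs])"
| "lrotate (LNode v []) = LNode v []"

fun rotate_root :: "plane_tree \<Rightarrow> plane_tree" where
  "rotate_root (Node (Node as # bs)) = Node (as @ [Node bs])"
| "rotate_root (Node []) = Node []"

fun root_edge :: "'v ltree \<Rightarrow> 'v set" where
  "root_edge (LNode v (t # ts)) = {v, lroot t}"
| "root_edge (LNode v []) = {}"

lemma lroot_in_lverts: "lroot t \<in> set (lverts t)"
  by (cases t) simp

lemma ledges_subset_lverts: "e \<in> set (ledges t) \<Longrightarrow> e \<subseteq> set (lverts t)"
proof (induction t arbitrary: e)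
  case (LNode v ts)
  then show ?case using lroot_in_lverts by fastforce
qed

lemma ledges_nonempty: "{} \<notin> set (ledges t)"
  by (induction t) auto

lemma length_lverts: "length (lverts t) = Suc (length (ledges t))"
  by (induction t) (auto simp: length_concat o_def intro!: arg_cong[where f = sum_list])

text \<open>
  An edge within the block of one child meets the vertices of that child, whereas the edges of the
  blocks of the later siblings avoid them.
\<close>

lemma distinct_ledges: "distinct (lverts t) \<Longrightarrow> distinct (ledges t)"
proof (induction t)
  case (LNode v ts)
  have "distinct (concat (map (\<lambda>t. {v, lroot t} # ledges t) us))"
    if "set us \<subseteq> set ts" "distinct (v # concat (map lverts us))" for us
    using that
  proof (induction us)
    case (Cons u us)
    have meets: "e \<inter> set (lverts u) \<noteq> {}" if "e \<in> set ({v, lroot u} # ledges u)" for e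
      using that ledges_subset_lverts[of e u] ledges_nonempty[of u] lroot_in_lverts[of u]
      by (cases "e = {}") (auto simp: Int_absorb2)
    have avoids: "e \<inter> set (lverts u) = {}"
      if e: "e \<in> set (concat (map (\<lambda>t. {v, lroot t} # ledges t) us))" for e
    proof -
      obtain t where t: "t \<in> set us" "e = {v, lroot t} \<or> e \<in> set (ledges t)" using e by auto
      then have "e \<subseteq> insert v (set (lverts t))"
        using ledges_subset_lverts[of e t] lroot_in_lverts[of t] by auto
      then show ?thesis using Cons.prems(2) t(1) by fastforce
    qed
    have "{v, lroot u} \<notin> set (ledges u)"
      using ledges_subset_lverts[of "{v, lroot u}" u] Cons.prems(2) by auto
    moreover have "distinct (ledges u)" using Cons.prems LNode.IH[of u] by simp
    moreover have "set ({v, lroot u} # ledges u) \<inter>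
        set (concat (map (\<lambda>t. {v, lroot t} # ledges t) us)) = {}"
      using meets avoids by blast
    moreover have "distinct (concat (map (\<lambda>t. {v, lroot t} # ledges t) us))"
      using Cons by simp
    ultimately show ?case by (simp add: distinct_append)
  qed simp
  from this[of ts] LNode.prems show ?case by simp
qed

lemma mset_ledges_lrotate: "mset (ledges (lrotate t)) = mset (ledges t)"
  by (cases t rule: lrotate.cases) (auto simp: insert_commute)

lemma mset_lverts_lrotate: "mset (lverts (lrotate t)) = mset (lverts t)"
  by (cases t rule: lrotate.cases) auto

lemma shape_lrotate: "shape (lrotate t) = rotate_root (shape t)"
  by (cases t rule: lrotate.cases) auto

lemma mset_ledges_lrotate_funpow: "mset (ledges ((lrotate ^^ i) t)) = mset (ledges t)"
  by (induction i) (simp_all add: mset_ledges_lrotate)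

lemma mset_lverts_lrotate_funpow: "mset (lverts ((lrotate ^^ i) t)) = mset (lverts t)"
  by (induction i) (simp_all add: mset_lverts_lrotate)

lemma shape_lrotate_funpow: "shape ((lrotate ^^ i) t) = (rotate_root ^^ i) (shape t)"
  by (induction i) (simp_all add: shape_lrotate)

text \<open>
  The contour walk starting from \<open>T\<close> reaches \<open>T'\<close> after \<open>n\<close> steps, and the function \<open>f\<close> summed over the edges
  crossed on the way is \<open>s\<close>.
\<close>

definition traverses :: "('v set \<Rightarrow> real) \<Rightarrow> 'v ltree \<Rightarrow> nat \<Rightarrow> real \<Rightarrow> 'v ltree \<Rightarrow> bool" where
  "traverses f T n s T' \<longleftrightarrow>
     (lrotate ^^ n) T = T' \<and> (\<Sum>i<n. f (root_edge ((lrotate ^^ i) T))) = s"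

lemma traverses_trans:
  assumes "traverses f T m s T'" "traverses f T' n s' T''"
  shows "traverses f T (m + n) (s + s') T''"
proof -
  have T': "(lrotate ^^ m) T = T'" using assms by (simp add: traverses_def)
  have shift: "(lrotate ^^ (i + m)) T = (lrotate ^^ i) T'" for i
    using T' by (simp add: funpow_add)
  have "(\<Sum>i<m + n. f (root_edge ((lrotate ^^ i) T))) =
          (\<Sum>i<m. f (root_edge ((lrotate ^^ i) T))) + (\<Sum>i<n. f (root_edge ((lrotate ^^ (i + m)) T)))"
    by (induction n) (simp_all add: add.commute)
  moreover have "(lrotate ^^ (m + n)) T = T''"
    using shift[of n] assms(2) by (simp add: traverses_def add.commute)
  ultimately show ?thesis using assms unfolding shift by (simp add: traverses_def)
qed

lemma traverses_step: "traverses f (LNode v (t # bs)) 1 (f {v, lroot t}) (lrotate (LNode v (t # bs)))"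
  by (simp add: traverses_def)

lemma traverses_children:
  assumes "\<And>t v bs. t \<in> set ts \<Longrightarrow> traverses f (LNode v (t # bs)) (2 * length (lverts t))
      (2 * (\<Sum>e\<leftarrow>{v, lroot t} # ledges t. f e)) (LNode v (bs @ [t]))"
  shows "traverses f (LNode v (ts @ bs)) (2 * length (concat (map lverts ts)))
      (2 * (\<Sum>e\<leftarrow>ledges (LNode v ts). f e)) (LNode v (bs @ ts))"
  using assms
proof (induction ts arbitrary: bs)
  case (Cons t ts)
  have "traverses f (LNode v (t # (ts @ bs))) (2 * length (lverts t))
      (2 * (\<Sum>e\<leftarrow>{v, lroot t} # ledges t. f e)) (LNode v ((ts @ bs) @ [t]))"
    by (rule Cons.prems) simp
  moreover have "traverses f (LNode v (ts @ (bs @ [t]))) (2 * length (concat (map lverts ts)))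
      (2 * (\<Sum>e\<leftarrow>ledges (LNode v ts). f e)) (LNode v ((bs @ [t]) @ ts))"
    by (rule Cons.IH, rule Cons.prems) simp
  ultimately show ?case
    using traverses_trans by (fastforce simp: algebra_simps)
qed (simp add: traverses_def)

text \<open>
  Walking around the first subtree crosses the edge to it, walks around all its children, and crosses
  the same edge back; the subtree has then become the last child.
\<close>

lemma traverses_subtree:
  "traverses f (LNode v (t # bs)) (2 * length (lverts t))
      (2 * (\<Sum>e\<leftarrow>{v, lroot t} # ledges t. f e)) (LNode v (bs @ [t]))"
proof (induction t arbitrary: v bs)
  case (LNode c as)
  have "traverses f (LNode v (LNode c as # bs)) 1 (f {v, c}) (LNode c (as @ [LNode v bs]))"
    using traverses_step[of f v "LNode c as" bs] by simp
  moreover have "traverses f (LNode c (as @ [LNode v bs])) (2 * length (concat (map lverts as)))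
      (2 * (\<Sum>e\<leftarrow>ledges (LNode c as). f e)) (LNode c ([LNode v bs] @ as))"
    by (rule traverses_children) (use LNode.IH in blast)
  moreover have "traverses f (LNode c ([LNode v bs] @ as)) 1 (f {v, c}) (LNode v (bs @ [LNode c as]))"
    using traverses_step[of f c "LNode v bs" as] by (simp add: insert_commute)
  ultimately have "traverses f (LNode v (LNode c as # bs)) (1 + 2 * length (concat (map lverts as)) + 1)
     (f {v, c} + 2 * (\<Sum>e\<leftarrow>ledges (LNode c as). f e) + f {v, c}) (LNode v (bs @ [LNode c as]))"
    by (blast intro: traverses_trans)
  then show ?case by (simp add: algebra_simps)
qed

text \<open>
  The full contour walk crosses every edge exactly twice.
\<close>

lemma sum_root_edge_orbit:
  "(\<Sum>i<2 * length (ledges T). f (root_edge ((lrotate ^^ i) T))) = 2 * (\<Sum>e\<leftarrow>ledges T. f e :: real)"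
proof (cases T)
  case (LNode v ts)
  have "traverses f (LNode v (ts @ [])) (2 * length (concat (map lverts ts)))
      (2 * (\<Sum>e\<leftarrow>ledges (LNode v ts). f e)) (LNode v ([] @ ts))"
    by (rule traverses_children) (rule traverses_subtree)
  moreover have "length (concat (map lverts ts)) = length (ledges T)"
    using length_lverts[of T] LNode by simp
  ultimately show ?thesis using LNode by (simp add: traverses_def)
qed

text \<open>
  The product of the weights of the components that remain after the two endpoints of the edge from the
  root to its first child have been deleted. A single vertex has no such edge and gets weight 0.
\<close>

fun root_edge_weight :: "(plane_tree \<Rightarrow> real) \<Rightarrow> plane_tree \<Rightarrow> real" where
  "root_edge_weight w (Node (Node as # bs)) = (\<Prod>t\<leftarrow>as. w t) * (\<Prod>t\<leftarrow>bs. w t)"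
| "root_edge_weight w (Node []) = 0"

section \<open>Reduction to the root edge\<close>

text \<open>
  The names chosen here are exactly the Ulam--Harris labels, so that the edge set of the labelled tree
  is \<open>edges t\<close> (\<open>set_ledges_label_Nil\<close>).
\<close>

function label :: "nat list \<Rightarrow> plane_tree \<Rightarrow> nat list ltree" where
  "label v (Node ts) = LNode v (map (\<lambda>i. label (v @ [i]) (ts ! i)) [0..<length ts])"
  by pat_completeness auto
termination
  by (relation "Wellfounded.measure (size \<circ> snd)")
    (auto simp: less_Suc_eq_le intro!: size_list_estimation'[OF nth_mem])

lemma lroot_label: "lroot (label v t) = v"
  by (cases t) simp

lemma shape_label: "shape (label v t) = t"
proof (induction v t rule: label.induct)
  case (1 v ts)
  then have "map shape (map (\<lambda>i. label (v @ [i]) (ts ! i)) [0..<length ts]) = map ((!) ts) [0..<length ts]"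
    by simp
  then show ?case by (simp add: map_nth)
qed

lemma set_lverts_label: "set (lverts (label v t)) = (@) v ` vertices t"
proof (induction v t rule: label.induct)
  case (1 v ts)
  then have "set (lverts (label v (Node ts))) =
      insert v (\<Union>i<length ts. (@) (v @ [i]) ` vertices (ts ! i))"
    by auto
  also have "\<dots> = (@) v ` vertices (Node ts)"
    by (force simp: image_UN image_image)
  finally show ?case .
qed

lemma distinct_lverts_label: "distinct (lverts (label v t))"
proof (induction v t rule: label.induct)
  case (1 v ts)
  let ?l = "\<lambda>i. lverts (label (v @ [i]) (ts ! i))"
  have disj: "set (?l i) \<inter> set (?l j) = {}" if "i \<noteq> j" for i j
    using that by (auto simp: set_lverts_label)
  have "inj_on ?l {0..<length ts}"
  proof (rule inj_onI)
    fix i j assume eq: "?l i = ?l j"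
    have "set (?l i) \<noteq> {}" by (metis lroot_in_lverts empty_iff)
    then show "i = j" using disj[of i j] eq by (metis inf.idem)
  qed
  then have "distinct (concat (map ?l [0..<length ts]))"
  proof (intro distinct_concat)
    fix ys zs assume "ys \<in> set (map ?l [0..<length ts])" "zs \<in> set (map ?l [0..<length ts])" "ys \<noteq> zs"
    then obtain i j where "ys = ?l i" "zs = ?l j" "i \<noteq> j" by auto
    then show "set ys \<inter> set zs = {}" using disj by simp
  qed (use 1 in \<open>auto simp: distinct_map\<close>)
  moreover have "v \<notin> set (concat (map ?l [0..<length ts]))"
    by (auto simp: set_lverts_label)
  ultimately show ?case by (simp add: o_def)
qed

lemma set_ledges_label: "set (ledges (label v t)) = {{v @ u, v @ u @ [i]} |u i. u @ [i] \<in> vertices t}"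
proof (induction v t rule: label.induct)
  case (1 v ts)
  have root: "[] \<in> vertices t" for t by (cases t) simp
  have "set (ledges (label v (Node ts))) =
      (\<Union>j<length ts. insert {v, v @ [j]}
         {{v @ j # u, v @ j # u @ [i]} |u i. u @ [i] \<in> vertices (ts ! j)})" (is "_ = ?L")
    using 1 by (auto simp: lroot_label)
  also have "\<dots> = {{v @ u, v @ u @ [i]} |u i. u @ [i] \<in> vertices (Node ts)}" (is "_ = ?R")
  proof (rule subset_antisym)
    show "?L \<subseteq> ?R"
    proof
      fix e assume "e \<in> ?L"
      then consider j where "j < length ts" "e = {v @ [], v @ [] @ [j]}"
        | j u i where "j < length ts" "e = {v @ (j # u), v @ (j # u) @ [i]}" "u @ [i] \<in> vertices (ts ! j)"
        by auto
      then show "e \<in> ?R"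
      proof cases
        case 1
        moreover have "[] @ [j] \<in> vertices (Node ts)" using 1 root[of "ts ! j"] by auto
        ultimately show ?thesis by blast
      next
        case 2
        moreover have "(j # u) @ [i] \<in> vertices (Node ts)" using 2 by auto
        ultimately show ?thesis by blast
      qed
    qed
    show "?R \<subseteq> ?L"
    proof
      fix e assume "e \<in> ?R"
      then obtain u i where e: "e = {v @ u, v @ u @ [i]}" "u @ [i] \<in> vertices (Node ts)" by blast
      then show "e \<in> ?L" by (cases u) auto
    qed
  qed
  finally show ?case .
qed

lemma set_ledges_label_Nil: "set (ledges (label [] t)) = edges t"
  by (simp add: set_ledges_label edges_def)

lemma length_ledges_label: "Suc (length (ledges (label v t))) = card (vertices t)"
proof -
  have "Suc (length (ledges (label v t))) = card (set (lverts (label v t)))"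
    using distinct_card[OF distinct_lverts_label] by (simp add: length_lverts)
  also have "\<dots> = card (vertices t)"
    unfolding set_lverts_label by (intro card_image) (simp add: inj_on_def)
  finally show ?thesis .
qed

lemma greedy_pgf_forest:
  "distinct (concat (map lverts ts)) \<Longrightarrow>
     greedy_pgf y (set (concat (map ledges ts))) = (\<Prod>t\<leftarrow>ts. greedy_pgf y (set (ledges t)))"
proof (induction ts)
  case (Cons t ts)
  have "greedy_pgf y (set (ledges t) \<union> set (concat (map ledges ts))) =
          greedy_pgf y (set (ledges t)) * greedy_pgf y (set (concat (map ledges ts)))"
  proof (rule greedy_pgf_Un)
    fix a b assume ab: "a \<in> set (ledges t)" "b \<in> set (concat (map ledges ts))"
    then have "a \<subseteq> set (lverts t)" "b \<subseteq> set (concat (map lverts ts))"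
      using ledges_subset_lverts by fastforce+
    then show "a \<inter> b = {}" using Cons.prems by auto
  qed (use ledges_nonempty in auto)
  with Cons show ?case by simp
qed (simp add: greedy_pgf_empty)

lemma ledges_avoiding_root_edge:
  assumes "distinct (lverts (LNode v (LNode c as # bs)))"
  shows "{f \<in> set (ledges (LNode v (LNode c as # bs))). f \<inter> {v, c} = {}} =
           set (concat (map ledges (as @ bs)))"
proof -
  have "f \<inter> {v, c} = {}" if f: "f \<in> set (concat (map ledges (as @ bs)))" for f
  proof -
    have "f \<subseteq> set (concat (map lverts (as @ bs)))"
      using f ledges_subset_lverts by fastforce
    with assms show ?thesis by auto
  qed
  then show ?thesis by auto
qed

text \<open>
  The edges that do not meet the root edge form vertex-disjoint subtrees, which evolve independently.
\<close>

lemma greedy_pgf_avoiding_root_edge: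
  assumes "distinct (lverts (LNode v (LNode c as # bs)))"
  shows "greedy_pgf y {f \<in> set (ledges (LNode v (LNode c as # bs))). f \<inter> {v, c} = {}} =
           (\<Prod>t\<leftarrow>as @ bs. greedy_pgf y (set (ledges t)))"
  unfolding ledges_avoiding_root_edge[OF assms]
  by (rule greedy_pgf_forest) (use assms in auto)

text \<open>
  The sum over the first kept edge is rewritten as half the sum over the contour walk, along which the
  first kept edge is always the root edge.
\<close>

lemma greedy_pgf_ledges_rec:
  assumes "distinct (lverts T)"
  shows "real (length (ledges T)) * greedy_pgf y (set (ledges T)) =
           y / 2 * (\<Sum>i<2 * length (ledges T). greedy_pgf y
             {f \<in> set (ledges ((lrotate ^^ i) T)). f \<inter> root_edge ((lrotate ^^ i) T) = {}})"
proof -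
  let ?F = "\<lambda>e. greedy_pgf y {f \<in> set (ledges T). f \<inter> e = {}}"
  have same: "set (ledges ((lrotate ^^ i) T)) = set (ledges T)" for i
    using mset_ledges_lrotate_funpow by (rule mset_eq_setD)
  have "real (length (ledges T)) * greedy_pgf y (set (ledges T)) = y * (\<Sum>e\<in>set (ledges T). ?F e)"
    using greedy_pgf_rec[of "set (ledges T)" y] distinct_card[OF distinct_ledges[OF assms]]
      ledges_nonempty[of T] by simp
  also have "(\<Sum>e\<in>set (ledges T). ?F e) = (\<Sum>e\<leftarrow>ledges T. ?F e)"
    by (rule sum.distinct_set_conv_list) (rule distinct_ledges[OF assms])
  also have "y * \<dots> = y / 2 * (\<Sum>i<2 * length (ledges T). ?F (root_edge ((lrotate ^^ i) T)))"
    using sum_root_edge_orbit[where f = ?F and T = T] by simp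
  finally show ?thesis by (simp add: same)
qed

lemma shape_lrotate_eq: "shape T = shape T' \<Longrightarrow> shape ((lrotate ^^ i) T) = shape ((lrotate ^^ i) T')"
  by (simp add: shape_lrotate_funpow)

lemma length_ledges_shape: "Suc (length (ledges T)) = card (vertices (shape T))"
proof (induction T)
  case (LNode v ts)
  then show ?case
    by (simp add: card_vertices_Node length_concat o_def del: vertices.simps cong: map_cong)
qed

lemma length_ledges_children: "length (concat (map ledges ts)) \<le> length (ledges (LNode v ts))"
  by (simp add: length_concat o_def sum_list_mono)

text \<open>
  The law of the greedy matching does not depend on the names of the vertices. In the recursion
  \<open>greedy_pgf_ledges_rec\<close>, the factors belong to smaller trees whose shapes are determined by the
  shape of the whole tree; this makes induction work without constructing any graph isomorphism.
\<close>

lemma greedy_pgf_cong_shape: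
  assumes "distinct (lverts T)" "distinct (lverts T')" "shape T = shape T'"
  shows "greedy_pgf y (set (ledges T)) = greedy_pgf y (set (ledges T'))"
  using assms
proof (induction "length (ledges T)" arbitrary: T T' rule: less_induct)
  case less
  let ?n = "length (ledges T)"
  have n: "length (ledges T') = ?n"
    using length_ledges_shape[of T] length_ledges_shape[of T'] less.prems by simp
  show ?case
  proof (cases "?n = 0")
    case True
    with n show ?thesis by (simp add: greedy_pgf_empty)
  next
    case False
    let ?h = "\<lambda>T. greedy_pgf y {f \<in> set (ledges T). f \<inter> root_edge T = {}}"
    have h: "?h ((lrotate ^^ i) T) = ?h ((lrotate ^^ i) T')" for i
    proof -
      define R R' where R_def: "R = (lrotate ^^ i) T" and R'_def: "R' = (lrotate ^^ i) T'"
      have dist: "distinct (lverts R)" "distinct (lverts R')"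
        using less.prems mset_eq_imp_distinct_iff[OF mset_lverts_lrotate_funpow]
        by (auto simp: R_def R'_def)
      have len: "length (ledges R) = ?n"
        unfolding R_def using mset_ledges_lrotate_funpow by (rule mset_eq_length)
      have shape: "shape R = shape R'"
        unfolding R_def R'_def using less.prems(3) by (rule shape_lrotate_eq)
      obtain v c as bs where R: "R = LNode v (LNode c as # bs)"
        using len False by (cases R rule: lrotate.cases) auto
      obtain v' c' as' bs' where R': "R' = LNode v' (LNode c' as' # bs')"
        using shape R by (cases R' rule: lrotate.cases) auto
      have "map shape as = map shape as'" "map shape bs = map shape bs'"
        using shape R R' by auto
      then have ab: "map shape (as @ bs) = map shape (as' @ bs')" by simp
      have "map (\<lambda>t. greedy_pgf y (set (ledges t))) (as @ bs) =
            map (\<lambda>t. greedy_pgf y (set (ledges t))) (as' @ bs')"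
      proof (rule nth_equalityI)
        show "length (map (\<lambda>t. greedy_pgf y (set (ledges t))) (as @ bs)) =
              length (map (\<lambda>t. greedy_pgf y (set (ledges t))) (as' @ bs'))"
          using arg_cong[OF ab, of length] by simp
        fix j assume "j < length (map (\<lambda>t. greedy_pgf y (set (ledges t))) (as @ bs))"
        then have j: "j < length (as @ bs)" "j < length (as' @ bs')"
          using arg_cong[OF ab, of length] by simp_all
        define t t' where t_def: "t = (as @ bs) ! j" and t'_def: "t' = (as' @ bs') ! j"
        have mem: "t \<in> set (as @ bs)" "t' \<in> set (as' @ bs')"
          using j unfolding t_def t'_def by (simp_all only: nth_mem)
        have "shape t = shape t'"
          using arg_cong[OF ab, of "\<lambda>xs. xs ! j"] j by (simp add: t_def t'_def del: map_append)
        moreover have "distinct (lverts t)" "distinct (lverts t')"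
          using mem dist R R' by (auto simp: distinct_concat_iff)
        moreover have "length (ledges t) < ?n"
        proof -
          have "length (ledges t) \<le> length (concat (map ledges (as @ bs)))"
            unfolding length_concat using mem(1) by (intro member_le_sum_list) auto
          also have "\<dots> < length (ledges R)"
            using add_mono[OF length_ledges_children[of as c] length_ledges_children[of bs v]]
            by (simp add: R)
          finally show ?thesis by (simp add: len)
        qed
        ultimately show "map (\<lambda>t. greedy_pgf y (set (ledges t))) (as @ bs) ! j =
            map (\<lambda>t. greedy_pgf y (set (ledges t))) (as' @ bs') ! j"
          using less.hyps[of t t'] j by (simp add: t_def t'_def del: map_append)
      qed
      then show ?thesis
        using greedy_pgf_avoiding_root_edge[of v c as bs y]
          greedy_pgf_avoiding_root_edge[of v' c' as' bs' y] dist
        unfolding R_def[symmetric] R'_def[symmetric] by (simp add: R R' del: map_append)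
    qed
    have "real ?n * greedy_pgf y (set (ledges T)) = real ?n * greedy_pgf y (set (ledges T'))"
      by (rule trans[OF greedy_pgf_ledges_rec[OF less.prems(1), of y, unfolded h]
            greedy_pgf_ledges_rec[OF less.prems(2), of y, unfolded n, symmetric]])
    with False show ?thesis by simp
  qed
qed

definition tree_pgf :: "real \<Rightarrow> plane_tree \<Rightarrow> real" where
  "tree_pgf y t = greedy_pgf y (edges t)"

lemma greedy_pgf_ledges:
  assumes "distinct (lverts T)"
  shows "greedy_pgf y (set (ledges T)) = tree_pgf y (shape T)"
proof -
  have "greedy_pgf y (set (ledges T)) = greedy_pgf y (set (ledges (label [] (shape T))))"
    by (rule greedy_pgf_cong_shape) (simp_all add: assms distinct_lverts_label shape_label)
  then show ?thesis by (simp add: set_ledges_label_Nil tree_pgf_def)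
qed

text \<open>
  The recursion along the contour walk, stated purely in terms of unlabelled trees.
\<close>

lemma tree_pgf_rec:
  assumes n: "card (vertices t) = Suc n"
  shows "real n * tree_pgf y t =
           y / 2 * (\<Sum>i<2 * n. root_edge_weight (tree_pgf y) ((rotate_root ^^ i) t))"
proof (cases "n = 0")
  case False
  define T where "T = label [] t"
  have dist: "distinct (lverts T)" by (simp add: T_def distinct_lverts_label)
  have len: "length (ledges T) = n" using n length_ledges_label[of "[]" t] by (simp add: T_def)
  have "greedy_pgf y {f \<in> set (ledges ((lrotate ^^ i) T)). f \<inter> root_edge ((lrotate ^^ i) T) = {}} =
          root_edge_weight (tree_pgf y) ((rotate_root ^^ i) t)" for i
  proof -
    define R where R_def: "R = (lrotate ^^ i) T"
    have distR: "distinct (lverts R)"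
      using dist mset_eq_imp_distinct_iff[OF mset_lverts_lrotate_funpow] by (auto simp: R_def)
    have "length (ledges R) = n"
      unfolding R_def len[symmetric] using mset_ledges_lrotate_funpow by (rule mset_eq_length)
    then obtain v c as bs where R: "R = LNode v (LNode c as # bs)"
      using False by (cases R rule: lrotate.cases) auto
    have "greedy_pgf y {f \<in> set (ledges R). f \<inter> {v, c} = {}} =
        (\<Prod>t\<leftarrow>as @ bs. greedy_pgf y (set (ledges t)))"
      unfolding R by (rule greedy_pgf_avoiding_root_edge) (use distR R in simp)
    also have "map (\<lambda>t. greedy_pgf y (set (ledges t))) (as @ bs) = map (tree_pgf y \<circ> shape) (as @ bs)"
      using distR R by (intro map_cong refl) (auto simp: distinct_concat_iff intro!: greedy_pgf_ledges)
    also have "prod_list \<dots> = root_edge_weight (tree_pgf y) (shape R)"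
      by (simp add: R o_def)
    also have "shape R = (rotate_root ^^ i) t"
      by (simp add: R_def shape_lrotate_funpow T_def shape_label)
    finally show ?thesis by (simp add: R R_def[symmetric])
  qed
  then show ?thesis
    using greedy_pgf_ledges_rec[OF dist, of y] len
    by (simp add: greedy_pgf_ledges[OF dist]) (simp add: T_def shape_label)
qed simp

lemma inj_on_rotate_root: "inj_on rotate_root (- {Node []})"
proof (rule inj_onI)
  fix s t assume "s \<in> - {Node []}" "t \<in> - {Node []}" "rotate_root s = rotate_root t"
  then show "s = t"
    by (cases s rule: rotate_root.cases; cases t rule: rotate_root.cases) auto
qed

lemma card_vertices_rotate_root: "card (vertices (rotate_root t)) = card (vertices t)"
  by (cases t rule: rotate_root.cases) (simp_all add: card_vertices_Node del: vertices.simps)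

lemma bij_betw_rotate_root:
  assumes "n \<ge> 2"
  shows "bij_betw rotate_root (plane_trees n) (plane_trees n)"
proof -
  have "Node [] \<notin> plane_trees n" using assms by (simp add: plane_trees_def)
  then have inj: "inj_on rotate_root (plane_trees n)"
    by (intro inj_on_subset[OF inj_on_rotate_root]) auto
  have "rotate_root ` plane_trees n \<subseteq> plane_trees n"
    by (auto simp: plane_trees_def card_vertices_rotate_root)
  with inj show ?thesis
    by (simp add: bij_betw_def endo_inj_surj finite_plane_trees)
qed

lemma sum_rotate_root_funpow:
  fixes f :: "plane_tree \<Rightarrow> real"
  assumes "n \<ge> 2"
  shows "(\<Sum>t\<in>plane_trees n. f ((rotate_root ^^ i) t)) = (\<Sum>t\<in>plane_trees n. f t)"
proof (induction i)
  case (Suc i)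
  have "(\<Sum>t\<in>plane_trees n. f ((rotate_root ^^ Suc i) t)) =
        (\<Sum>t\<in>plane_trees n. f ((rotate_root ^^ i) (rotate_root t)))"
    by (simp only: funpow_Suc_right o_def)
  also have "\<dots> = (\<Sum>t\<in>plane_trees n. f ((rotate_root ^^ i) t))"
    by (rule sum.reindex_bij_betw[OF bij_betw_rotate_root[OF assms]])
  finally show ?case using Suc by simp
qed simp

text \<open>
  Each \<open>rotate_root ^^ i\<close> permutes the trees of size \<open>n\<close>, so each of the \<open>2 (n - 1)\<close> steps of the contour
  walk contributes the same total; the factors \<open>n - 1\<close> and 2 cancel.
\<close>

lemma sum_tree_pgf:
  assumes "n \<ge> 2"
  shows "(\<Sum>t\<in>plane_trees n. tree_pgf y t) =
           y * (\<Sum>t\<in>plane_trees n. root_edge_weight (tree_pgf y) t)"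
proof -
  obtain m where m: "n = Suc m" "m > 0" using assms by (cases n) auto
  have "real m * (\<Sum>t\<in>plane_trees n. tree_pgf y t) =
      (\<Sum>t\<in>plane_trees n. y / 2 * (\<Sum>i<2 * m. root_edge_weight (tree_pgf y) ((rotate_root ^^ i) t)))"
    by (subst sum_distrib_left, intro sum.cong refl tree_pgf_rec) (simp add: plane_trees_def m)
  also have "\<dots> = y / 2 * (\<Sum>i<2 * m. \<Sum>t\<in>plane_trees n.
      root_edge_weight (tree_pgf y) ((rotate_root ^^ i) t))"
    by (simp only: sum_distrib_left[symmetric] sum.swap[of _ "plane_trees n"])
  also have "\<dots> = real m * (y * (\<Sum>t\<in>plane_trees n. root_edge_weight (tree_pgf y) t))"
    by (simp add: sum_rotate_root_funpow[OF assms])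
  finally show ?thesis using m by simp
qed

section \<open>Generating functions and the exact law\<close>

definition forests :: "nat \<Rightarrow> plane_tree list set" where
  "forests n = {ts. (\<Sum>t\<leftarrow>ts. card (vertices t)) = n}"

lemma plane_trees_0: "plane_trees 0 = {}"
proof -
  have "card (vertices t) \<noteq> 0" for t by (cases t) (simp add: card_vertices_Node del: vertices.simps)
  then show ?thesis by (simp add: plane_trees_def)
qed

lemma plane_trees_Suc: "plane_trees (Suc n) = Node ` forests n"
proof -
  have "t \<in> plane_trees (Suc n) \<longleftrightarrow> t \<in> Node ` forests n" for t
    by (cases t) (auto simp: plane_trees_def forests_def card_vertices_Node simp del: vertices.simps)
  then show ?thesis by blast
qed

lemma finite_forests: "finite (forests n)"
  using finite_plane_trees[of "Suc n"] unfolding plane_trees_Suc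
  by (rule finite_imageD) (simp add: inj_on_def)

lemma forests_0: "forests 0 = {[]}"
proof -
  have "card (vertices t) > 0" for t by (cases t) (simp add: card_vertices_Node del: vertices.simps)
  then show ?thesis
    by (auto simp: forests_def neq_Nil_conv) (metis list.exhaust list.set_intros(1) less_numeral_extra(3))
qed

definition tree_fps :: "(plane_tree \<Rightarrow> real) \<Rightarrow> real fps" where
  "tree_fps w = Abs_fps (\<lambda>n. \<Sum>t\<in>plane_trees n. w t)"

definition forest_fps :: "(plane_tree \<Rightarrow> real) \<Rightarrow> real fps" where
  "forest_fps w = Abs_fps (\<lambda>n. \<Sum>ts\<in>forests n. \<Prod>t\<leftarrow>ts. w t)"

text \<open>
  A forest is empty or consists of a first tree and a forest, hence \<open>S = 1 / (1 - G)\<close>.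
\<close>

lemma forest_fps_unfold: "forest_fps w = 1 + tree_fps w * forest_fps w"
proof (rule fps_ext)
  fix n
  let ?T = "SIGMA i:{0..n}. plane_trees i \<times> forests (n - i)"
  have bij: "bij_betw (\<lambda>(i, t, ts). t # ts) ?T (forests n - {[]})"
  proof (rule bij_betwI[where g = "\<lambda>ts. (card (vertices (hd ts)), hd ts, tl ts)"])
    show "(\<lambda>ts. (card (vertices (hd ts)), hd ts, tl ts)) \<in> forests n - {[]} \<rightarrow> ?T"
      by (auto simp: plane_trees_def forests_def neq_Nil_conv)
  qed (auto simp: plane_trees_def forests_def)
  have "(tree_fps w * forest_fps w) $ n =
      (\<Sum>i=0..n. \<Sum>t\<in>plane_trees i. \<Sum>ts\<in>forests (n - i). w t * (\<Prod>t\<leftarrow>ts. w t))"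
    by (simp add: fps_mult_nth tree_fps_def forest_fps_def sum_product)
  also have "\<dots> = (\<Sum>(i, t, ts)\<in>?T. \<Prod>t\<leftarrow>t # ts. w t)"
    by (simp add: sum.cartesian_product sum.Sigma finite_plane_trees finite_forests)
  also have "\<dots> = (\<Sum>ts\<in>forests n - {[]}. \<Prod>t\<leftarrow>ts. w t)"
    using sum.reindex_bij_betw[OF bij, of "\<lambda>ts. \<Prod>t\<leftarrow>ts. w t"] by (simp add: case_prod_unfold)
  also have "\<dots> = (\<Sum>ts\<in>forests n. \<Prod>t\<leftarrow>ts. w t) - (if n = 0 then 1 else 0)"
  proof (cases "n = 0")
    case False
    then have "[] \<notin> forests n" by (simp add: forests_def)
    with False show ?thesis by simp
  qed (simp add: forests_0)
  finally show "forest_fps w $ n = (1 + tree_fps w * forest_fps w) $ n"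
    by (simp add: forest_fps_def)
qed

text \<open>
  A tree with at least two vertices consists of the forest below the first child of the root and the
  forest of the later children.
\<close>

lemma sum_root_edge_weight:
  "(\<Sum>t\<in>plane_trees (n + 2). root_edge_weight w t) = (forest_fps w ^ 2) $ n"
proof -
  let ?T = "SIGMA i:{0..n}. forests i \<times> forests (n - i)"
  let ?size = "\<lambda>ts. \<Sum>t\<leftarrow>ts. card (vertices t)"
  have nonleaf: "\<exists>as bs. t = Node (Node as # bs) \<and> as \<in> forests (?size as) \<and> ?size as + ?size bs = n"
    if "t \<in> plane_trees (n + 2)" for t
    using that by (cases t rule: rotate_root.cases)
      (auto simp: plane_trees_def forests_def card_vertices_Node simp del: vertices.simps)
  have bij: "bij_betw (\<lambda>(i, as, bs). Node (Node as # bs)) ?T (plane_trees (n + 2))"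
  proof (rule bij_betw_imageI)
    show "inj_on (\<lambda>(i, as, bs). Node (Node as # bs)) ?T"
      by (auto simp: inj_on_def forests_def)
    show "(\<lambda>(i, as, bs). Node (Node as # bs)) ` ?T = plane_trees (n + 2)"
    proof (rule subset_antisym)
      show "(\<lambda>(i, as, bs). Node (Node as # bs)) ` ?T \<subseteq> plane_trees (n + 2)"
        by (auto simp: plane_trees_def forests_def card_vertices_Node simp del: vertices.simps)
      show "plane_trees (n + 2) \<subseteq> (\<lambda>(i, as, bs). Node (Node as # bs)) ` ?T"
      proof
        fix t assume "t \<in> plane_trees (n + 2)"
        from nonleaf[OF this] obtain as bs
          where t: "t = Node (Node as # bs)" and n: "?size as + ?size bs = n" by blast
        have "(?size as, as, bs) \<in> ?T" using n by (auto simp: forests_def)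
        then show "t \<in> (\<lambda>(i, as, bs). Node (Node as # bs)) ` ?T"
          using t by (intro image_eqI[where x = "(?size as, as, bs)"]) simp_all
      qed
    qed
  qed
  have "(forest_fps w ^ 2) $ n =
      (\<Sum>i=0..n. \<Sum>as\<in>forests i. \<Sum>bs\<in>forests (n - i). (\<Prod>t\<leftarrow>as. w t) * (\<Prod>t\<leftarrow>bs. w t))"
    by (simp add: power2_eq_square fps_mult_nth forest_fps_def sum_product)
  also have "\<dots> = (\<Sum>(i, as, bs)\<in>?T. root_edge_weight w (Node (Node as # bs)))"
    by (simp add: sum.cartesian_product sum.Sigma finite_forests)
  also have "\<dots> = (\<Sum>t\<in>plane_trees (n + 2). root_edge_weight w t)"
    using sum.reindex_bij_betw[OF bij, of "root_edge_weight w"] by (simp add: case_prod_unfold)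
  finally show ?thesis ..
qed

text \<open>
  The functional equation \<open>G = z + y z\<^sup>2 S\<^sup>2\<close>.
\<close>

lemma tree_fps_greedy:
  "tree_fps (tree_pgf y) = fps_X + fps_const y * fps_X ^ 2 * forest_fps (tree_pgf y) ^ 2"
proof (rule fps_ext)
  fix n :: nat
  have leaf: "tree_pgf y (Node []) = 1"
    by (simp add: tree_pgf_def edges_def greedy_pgf_empty)
  consider "n = 0" | "n = 1" | m where "n = m + 2"
    by (metis One_nat_def add_2_eq_Suc' old.nat.exhaust)
  then show "tree_fps (tree_pgf y) $ n =
      (fps_X + fps_const y * fps_X ^ 2 * forest_fps (tree_pgf y) ^ 2) $ n"
  proof cases
    case 1
    then show ?thesis by (simp add: tree_fps_def plane_trees_0 mult.assoc fps_X_power_mult_nth)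
  next
    case 2
    then show ?thesis
      by (simp add: tree_fps_def plane_trees_Suc forests_0 leaf mult.assoc fps_X_power_mult_nth)
  next
    case (3 m)
    have "tree_fps (tree_pgf y) $ n = y * (forest_fps (tree_pgf y) ^ 2) $ m"
      using sum_tree_pgf[of n y] unfolding 3 sum_root_edge_weight by (simp add: tree_fps_def)
    then show ?thesis by (simp add: 3 mult.assoc fps_X_power_mult_nth)
  qed
qed

text \<open>
  The coefficient of \<open>y\<^sup>k z\<^sup>m\<^sup>+\<^sup>2\<^sup>k\<close> in \<open>S\<^sup>r\<close>, as given by Lagrange inversion. The case \<open>r = 0\<close> is singled out because
  the general formula would give 0 instead of 1 at \<open>m = k = 0\<close>.
\<close>

definition matching_number :: "nat \<Rightarrow> nat \<Rightarrow> nat \<Rightarrow> real" where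
  "matching_number r m k =
     (if r = 0 then of_bool (m = 0 \<and> k = 0)
      else real r * fact (m + 3 * k + r - 1) / (fact (2 * k + r) * fact k * fact m))"

text \<open>
  With \<open>N + 1 = m + 3 k + r\<close> and the common denominator \<open>D = (2 k + r + 1)! k! m!\<close>, every term is
  \<open>N! / D\<close> times a polynomial, and the claim reduces to
  \<open>(r + 1) (m + 3 k + r) = r (2 k + r + 1) + (r + 1) m + (r + 3) k\<close>.
\<close>

lemma matching_number_rec:
  "matching_number (Suc r) m k = matching_number r m k
     + (if m = 0 then 0 else matching_number (Suc r) (m - 1) k)
     + (if k = 0 then 0 else matching_number (r + 3) m (k - 1))"
proof (cases "m + 3 * k + r")
  case 0
  then show ?thesis by (simp add: matching_number_def)
next
  case (Suc N)
  define D :: real where "D = fact (2 * k + r + 1) * fact k * fact m"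
  have D: "D > 0" by (simp add: D_def)
  have 1: "matching_number (Suc r) m k = (r + 1) * real (Suc N) * fact N / D"
    using Suc by (simp add: matching_number_def D_def algebra_simps)
  have 2: "matching_number r m k = r * real (2 * k + r + 1) * fact N / D"
  proof (cases "r = 0")
    case False
    then have "m + 3 * k + r - 1 = N" using Suc by simp
    with False show ?thesis by (simp add: matching_number_def D_def divide_simps)
  qed (use Suc in \<open>auto simp: matching_number_def\<close>)
  have 3: "(if m = 0 then 0 else matching_number (Suc r) (m - 1) k) = (r + 1) * real m * fact N / D"
  proof (cases m)
    case (Suc m')
    then have "m' + 3 * k + Suc r - 1 = N" using \<open>m + 3 * k + r = Suc N\<close> by simp
    then show ?thesis unfolding Suc by (simp add: matching_number_def D_def Suc divide_simps)
  qed simp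
  have 4: "(if k = 0 then 0 else matching_number (r + 3) m (k - 1)) = (r + 3) * real k * fact N / D"
  proof (cases k)
    case (Suc k')
    then have "m + 3 * k' + (r + 3) - 1 = N" using \<open>m + 3 * k + r = Suc N\<close> by simp
    moreover have "2 * k' + (r + 3) = 2 * k + r + 1" using Suc by simp
    ultimately have "matching_number (r + 3) m k' =
        (r + 3) * fact N / (fact (2 * k + r + 1) * fact k' * fact m)"
      unfolding matching_number_def by (simp only:) simp
    also have "\<dots> = (r + 3) * real k * fact N / D"
    proof -
      have "(fact k :: real) = real k * fact k'" "real k > 0" using Suc by simp_all
      then show ?thesis by (simp add: D_def divide_simps del: fact_Suc)
    qed
    finally show ?thesis using Suc by simp
  qed simp
  have "(r + 1) * real (Suc N) = r * real (2 * k + r + 1) + (r + 1) * real m + (r + 3) * real k"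
    unfolding Suc[symmetric] by (simp add: algebra_simps)
  then show ?thesis unfolding 1 2 3 4 by (simp add: add_divide_distrib distrib_right)
qed

text \<open>
  Double induction on \<open>n\<close> and \<open>r\<close> along \<open>S\<^sup>r\<^sup>+\<^sup>1 = S\<^sup>r + z S\<^sup>r\<^sup>+\<^sup>1 + y z\<^sup>2 S\<^sup>r\<^sup>+\<^sup>3\<close>. The summation bound \<open>K\<close> is arbitrary
  so that polynomials in \<open>y\<close> arising from different \<open>n\<close> can be added over the same range.
\<close>

lemma fps_nth_forest_power_greedy:
  assumes "n \<le> K"
  shows "(forest_fps (tree_pgf y) ^ r) $ n =
           (\<Sum>k\<le>K. (if 2 * k \<le> n then matching_number r (n - 2 * k) k else 0) * y ^ k)"
  using assms
proof (induction n arbitrary: r K rule: less_induct)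
  case (less n)
  let ?S = "forest_fps (tree_pgf y)"
  let ?d = "\<lambda>r n k. if 2 * k \<le> n then matching_number r (n - 2 * k) k else 0"
  show ?case using less.prems
  proof (induction r)
    case 0
    have "(\<Sum>k\<le>K. ?d 0 n k * y ^ k) = (\<Sum>k\<in>{0}. ?d 0 n k * y ^ k)"
      by (rule sum.mono_neutral_right) (auto simp: matching_number_def)
    then show ?case by (simp add: matching_number_def)
  next
    case (Suc r)
    have "?S ^ Suc r = (1 + tree_fps (tree_pgf y) * ?S) * ?S ^ r"
      using forest_fps_unfold[of "tree_pgf y"] by simp
    also have "\<dots> = ?S ^ r + fps_X * ?S ^ Suc r + fps_const y * (fps_X ^ 2 * ?S ^ (r + 3))"
      unfolding tree_fps_greedy by (simp add: algebra_simps power_add power2_eq_square power3_eq_cube)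
    finally have "(?S ^ Suc r) $ n =
        (?S ^ r + fps_X * ?S ^ Suc r + fps_const y * (fps_X ^ 2 * ?S ^ (r + 3))) $ n"
      by (rule arg_cong)
    also have "\<dots> = (?S ^ r) $ n + (if n = 0 then 0 else (?S ^ Suc r) $ (n - 1))
        + y * (if n < 2 then 0 else (?S ^ (r + 3)) $ (n - 2))"
      by (simp add: fps_X_power_mult_nth del: power_Suc)
    also have "(?S ^ r) $ n = (\<Sum>k\<le>K. ?d r n k * y ^ k)"
      by (rule Suc.IH) (rule Suc.prems)
    also have "(if n = 0 then 0 else (?S ^ Suc r) $ (n - 1)) =
        (\<Sum>k\<le>K. (if n = 0 then 0 else ?d (Suc r) (n - 1) k) * y ^ k)"
      using less.IH[of "n - 1" K "Suc r"] Suc.prems by (simp del: power_Suc)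
    also have "y * (if n < 2 then 0 else (?S ^ (r + 3)) $ (n - 2)) =
        (\<Sum>k\<le>K. (if n < 2 \<or> k = 0 then 0 else ?d (r + 3) (n - 2) (k - 1)) * y ^ k)"
    proof (cases "n < 2")
      case False
      then obtain K' where K': "K = Suc K'" "n - 2 \<le> K'" using Suc.prems by (cases K) auto
      have "(?S ^ (r + 3)) $ (n - 2) = (\<Sum>k\<le>K'. ?d (r + 3) (n - 2) k * y ^ k)"
        by (rule less.IH) (use False K' in auto)
      then show ?thesis
        using False unfolding K'(1)
        by (subst sum.atMost_Suc_shift) (simp add: sum_distrib_left mult_ac cong: if_cong)
    qed simp
    also have "(\<Sum>k\<le>K. ?d r n k * y ^ k)
        + (\<Sum>k\<le>K. (if n = 0 then 0 else ?d (Suc r) (n - 1) k) * y ^ k)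
        + (\<Sum>k\<le>K. (if n < 2 \<or> k = 0 then 0 else ?d (r + 3) (n - 2) (k - 1)) * y ^ k)
        = (\<Sum>k\<le>K. ?d (Suc r) n k * y ^ k)"
    proof -
      have "?d (Suc r) n k = ?d r n k + (if n = 0 then 0 else ?d (Suc r) (n - 1) k)
          + (if n < 2 \<or> k = 0 then 0 else ?d (r + 3) (n - 2) (k - 1))" for k
      proof (cases "2 * k \<le> n")
        case True
        then have "(if n = 0 then 0 else ?d (Suc r) (n - 1) k) =
            (if n - 2 * k = 0 then 0 else matching_number (Suc r) (n - 2 * k - 1) k)"
          by (auto simp: diff_commute)
        moreover have "(if n < 2 \<or> k = 0 then 0 else ?d (r + 3) (n - 2) (k - 1)) =
            (if k = 0 then 0 else matching_number (r + 3) (n - 2 * k) (k - 1))"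
        proof (cases k)
          case (Suc j)
          then have "\<not> n < 2" "2 * j \<le> n - 2" using True by auto
          then show ?thesis using Suc by simp
        qed simp
        ultimately show ?thesis using True matching_number_rec[of r "n - 2 * k" k] by simp
      qed auto
      then show ?thesis by (simp add: sum.distrib[symmetric] distrib_right[symmetric])
    qed
    finally show ?case .
  qed
qed

text \<open>
  The total weight is \<open>y [z\<^sup>n\<^sup>-\<^sup>2] S\<^sup>2\<close>; the factor \<open>y\<close> shifts the index, so that the coefficient of \<open>y\<^sup>k\<close> is
  \<open>matching_number 2 (n - 2 * k) (k - 1)\<close>.
\<close>

lemma sum_tree_pgf_closed_form:
  assumes "n \<ge> 2" "n \<le> K"
  shows "(\<Sum>t\<in>plane_trees n. tree_pgf y t) =
    (\<Sum>k\<le>K. (if 1 \<le> k \<and> 2 * k \<le> n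
       then fact (n + k - 2) / (fact k * fact (2 * k - 1) * fact (n - 2 * k)) else 0) * y ^ k)"
proof -
  obtain m where m: "n = m + 2" using assms(1) by (metis add.commute le_Suc_ex)
  obtain K' where K': "K = Suc K'" using assms by (cases K) auto
  have closed: "matching_number 2 (m - 2 * k) k =
      fact (m + k + 1) / (fact (Suc k) * fact (2 * k + 1) * fact (m - 2 * k))" if "2 * k \<le> m" for k
  proof -
    have "m - 2 * k + 3 * k + 2 - 1 = m + k + 1" using that by simp
    then have "matching_number 2 (m - 2 * k) k =
        2 * fact (m + k + 1) / (fact (2 * k + 2) * fact k * fact (m - 2 * k))"
      unfolding matching_number_def by (simp add: add_ac)
    also have "(fact (2 * k + 2) :: real) = 2 * ((real k + 1) * fact (2 * k + 1))"
      by (simp add: algebra_simps)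
    also have "2 * fact (m + k + 1) / (2 * ((real k + 1) * fact (2 * k + 1)) * fact k * fact (m - 2 * k)) =
        fact (m + k + 1) / (((real k + 1) * fact k) * fact (2 * k + 1) * fact (m - 2 * k))"
      unfolding mult.assoc mult_divide_mult_cancel_left_if by (simp only: mult_ac) simp
    finally show ?thesis by (simp add: add_ac)
  qed
  have "(\<Sum>t\<in>plane_trees n. tree_pgf y t) = y * (forest_fps (tree_pgf y) ^ 2) $ m"
    using sum_tree_pgf[OF assms(1)] unfolding m sum_root_edge_weight by simp
  also have "\<dots> = (\<Sum>k\<le>K'. (if 2 * k \<le> m then matching_number 2 (m - 2 * k) k else 0) * y ^ Suc k)"
    using assms m K' by (simp add: fps_nth_forest_power_greedy[of m K'] sum_distrib_left mult_ac)
  also have "\<dots> = (\<Sum>k\<le>K'. (if 2 * k \<le> m then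
      fact (m + k + 1) / (fact (Suc k) * fact (2 * k + 1) * fact (m - 2 * k)) else 0) * y ^ Suc k)"
    by (intro sum.cong refl) (simp add: closed del: fact_Suc)
  also have "\<dots> = (\<Sum>k\<le>K. (if 1 \<le> k \<and> 2 * k \<le> n
       then fact (n + k - 2) / (fact k * fact (2 * k - 1) * fact (n - 2 * k)) else 0) * y ^ k)"
    unfolding K' by (subst sum.atMost_Suc_shift) (simp add: m del: fact_Suc cong: if_cong)
  finally show ?thesis .
qed

text \<open>
  With all weights equal to 1, removing the root gives \<open>G = z S\<close>, hence \<open>S\<^sup>r\<^sup>+\<^sup>1 = S\<^sup>r + z S\<^sup>r\<^sup>+\<^sup>2\<close>; the ballot numbers
  satisfy this recursion.
\<close>

lemma fps_nth_forest_power_count: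
  "(forest_fps (\<lambda>_. 1) ^ r) $ n =
     (if r = 0 then of_bool (n = 0) else real r * fact (2 * n + r - 1) / (fact n * fact (n + r)))"
    (is "_ = ?e r n")
proof (induction n arbitrary: r rule: less_induct)
  case (less n)
  let ?S = "forest_fps (\<lambda>_. 1)"
  have one: "(\<Prod>t\<leftarrow>ts. 1) = (1 :: real)" for ts :: "plane_tree list"
    by (induction ts) simp_all
  have G: "tree_fps (\<lambda>_. 1) = fps_X * ?S"
  proof (rule fps_ext)
    fix m show "tree_fps (\<lambda>_. 1) $ m = (fps_X * ?S) $ m"
      by (cases m) (simp_all add: tree_fps_def forest_fps_def plane_trees_0 plane_trees_Suc
          one card_image inj_on_def)
  qed
  show ?case
  proof (induction r)
    case (Suc r)
    have "?S ^ Suc r = (1 + tree_fps (\<lambda>_. 1) * ?S) * ?S ^ r"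
      using forest_fps_unfold[of "\<lambda>_. 1"] by simp
    also have "\<dots> = ?S ^ r + fps_X * ?S ^ (r + 2)"
      unfolding G by (simp add: algebra_simps power_add power2_eq_square)
    finally have "(?S ^ Suc r) $ n = (?S ^ r + fps_X * ?S ^ (r + 2)) $ n"
      by (rule arg_cong)
    also have "\<dots> = (?S ^ r) $ n + (if n = 0 then 0 else (?S ^ (r + 2)) $ (n - 1))"
      by simp
    also have "\<dots> = ?e r n + (if n = 0 then 0 else ?e (r + 2) (n - 1))"
      using Suc less.IH[of "n - 1" "r + 2"] by (simp del: add_2_eq_Suc')
    also have "\<dots> = ?e (Suc r) n"
    proof (cases "2 * n + r")
      case 0
      then show ?thesis by simp
    next
      case eq: (Suc N)
      define D :: real where "D = fact n * fact (n + r + 1)"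
      have D: "D > 0" by (simp add: D_def)
      have 1: "?e (Suc r) n = (r + 1) * real (Suc N) * fact N / D"
        using eq by (simp add: D_def algebra_simps)
      have 2: "?e r n = r * real (n + r + 1) * fact N / D"
      proof (cases "r = 0")
        case False
        then have "2 * n + r - 1 = N" using eq by simp
        with False show ?thesis by (simp add: D_def divide_simps)
      qed (use eq in auto)
      have 3: "(if n = 0 then 0 else ?e (r + 2) (n - 1)) = (r + 2) * real n * fact N / D"
      proof (cases n)
        case (Suc m)
        then have "2 * m + (r + 2) - 1 = N" using eq by simp
        moreover have "m + (r + 2) = n + r + 1" using Suc by simp
        ultimately show ?thesis using Suc by (simp add: D_def divide_simps)
      qed simp
      have "(r + 1) * real (Suc N) = r * real (n + r + 1) + (r + 2) * real n"
        unfolding eq[symmetric] by (simp add: algebra_simps)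
      then show ?thesis unfolding 1 2 3 by (simp add: add_divide_distrib distrib_right)
    qed
    finally show ?case .
  qed simp
qed

lemma card_plane_trees:
  assumes "n \<ge> 1"
  shows "real (card (plane_trees n)) = fact (2 * n - 2) / (fact n * fact (n - 1))"
proof -
  obtain m where m: "n = Suc m" using assms by (cases n) auto
  have "(\<Prod>t\<leftarrow>ts. 1) = (1 :: real)" for ts :: "plane_tree list"
    by (induction ts) simp_all
  then have "real (card (plane_trees n)) = (forest_fps (\<lambda>_. 1) ^ 1) $ m"
    by (simp add: m forest_fps_def plane_trees_Suc card_image inj_on_def)
  then show ?thesis by (simp only: fps_nth_forest_power_count) (simp add: m)
qed

text \<open>
  Both sides of \<open>sum_tree_pgf_closed_form\<close> are polynomials in \<open>y\<close>, so their coefficients agree; the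
  number of trees is a Catalan number.
\<close>

lemma pmf_greedy_size_pmf:
  assumes "2 \<le> n" "1 \<le> k" "k \<le> n div 2"
  shows "pmf (greedy_size_pmf n) k =
           fact n * fact (n - 1) * fact (n + k - 2) /
             (fact k * fact (2 * k - 1) * fact (n - 2 * k) * fact (2 * n - 2))"
proof -
  have ne: "plane_trees n \<noteq> {}" using assms plane_trees_nonempty by simp
  have gs: "greedy_size_pmf n = pmf_of_set (plane_trees n) \<bind> (\<lambda>t. greedy_size (edges t))"
    by (simp add: greedy_size_pmf_def greedy_size_def)
  have fin: "finite (set_pmf (greedy_size_pmf n))"
    unfolding gs using ne by (simp add: finite_plane_trees finite_greedy_size finite_edges)
  then obtain K0 where K0: "set_pmf (greedy_size_pmf n) \<subseteq> {..K0}"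
    using finite_nat_iff_bounded_le by blast
  define K where "K = max n K0"
  let ?C = "real (card (plane_trees n))"
  let ?a = "\<lambda>k. if 1 \<le> k \<and> 2 * k \<le> n
       then fact (n + k - 2) / (fact k * fact (2 * k - 1) * fact (n - 2 * k)) else (0 :: real)"
  have C: "?C > 0" using ne finite_plane_trees[of n] by (simp add: card_gt_0_iff)
  have "(\<Sum>k\<le>K. ?C * pmf (greedy_size_pmf n) k * y ^ k) = (\<Sum>k\<le>K. ?a k * y ^ k)" for y :: real
  proof -
    have "measure_pmf.expectation (greedy_size_pmf n) (\<lambda>k. y ^ k) =
        (\<Sum>t\<in>plane_trees n. tree_pgf y t / ?C)"
      unfolding gs tree_pgf_def greedy_pgf_def
      by (subst pmf_expectation_bind_pmf_of_set)
        (simp_all add: ne finite_plane_trees finite_greedy_size finite_edges divide_inverse_commute)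
    moreover have "measure_pmf.expectation (greedy_size_pmf n) (\<lambda>k. y ^ k) =
        (\<Sum>k\<le>K. pmf (greedy_size_pmf n) k * y ^ k)"
      by (subst integral_measure_pmf[where A = "{..K}"]) (use K0 in \<open>auto simp: K_def\<close>)
    ultimately have "?C * (\<Sum>k\<le>K. pmf (greedy_size_pmf n) k * y ^ k) = (\<Sum>t\<in>plane_trees n. tree_pgf y t)"
      using C by (simp add: sum_divide_distrib[symmetric])
    also have "\<dots> = (\<Sum>k\<le>K. ?a k * y ^ k)"
      by (rule sum_tree_pgf_closed_form) (use assms in \<open>simp_all add: K_def\<close>)
    finally show ?thesis by (simp add: sum_distrib_left mult.assoc)
  qed
  then have "\<forall>k\<le>K. ?C * pmf (greedy_size_pmf n) k = ?a k"
    by (subst polyfun_eq_coeffs[symmetric]) blast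
  then have "?C * pmf (greedy_size_pmf n) k = ?a k" using assms by (simp add: K_def)
  moreover have "2 * k \<le> n" using assms by simp
  ultimately have "pmf (greedy_size_pmf n) k =
      fact (n + k - 2) / (fact k * fact (2 * k - 1) * fact (n - 2 * k)) / ?C"
    using C assms by (simp add: field_simps)
  then show ?thesis using assms by (simp add: card_plane_trees)
qed

lemma pmf_greedy_size_pmf_binomial:
  assumes "2 \<le> n" "1 \<le> k" "k \<le> n div 2"
  shows "pmf (greedy_size_pmf n) k =
    real n / real k * (real ((n + k - 2) choose (2 * k - 1)) * real ((n - k - 1) choose (k - 1)))
      / real ((2 * n - 2) choose (n - 1))"
proof -
  have k: "2 * k \<le> n" using assms by simp
  have 1: "real ((n + k - 2) choose (2 * k - 1)) = fact (n + k - 2) / (fact (2 * k - 1) * fact (n - k - 1))"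
    using k assms by (subst binomial_fact) (auto intro!: arg_cong[where f = fact])
  have 2: "real ((n - k - 1) choose (k - 1)) = fact (n - k - 1) / (fact (k - 1) * fact (n - 2 * k))"
    using k assms by (subst binomial_fact) (auto intro!: arg_cong[where f = fact])
  have 3: "real ((2 * n - 2) choose (n - 1)) = fact (2 * n - 2) / (fact (n - 1) * fact (n - 1))"
    using assms by (subst binomial_fact) (auto intro!: arg_cong[where f = fact])
  have 4: "(fact k :: real) = real k * fact (k - 1)" "(fact n :: real) = real n * fact (n - 1)"
    using assms by (simp_all add: fact_reduce)
  show ?thesis unfolding pmf_greedy_size_pmf[OF assms] 1 2 3 4
    using assms by (simp add: field_simps)
qed

section \<open>Stirling's formula and the rate function\<close>

text \<open>
  The constant \<open>ln (2 pi) / 2\<close> is left out of the approximation, so that it appears as the limit.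
\<close>

definition stirling_error :: "nat \<Rightarrow> real" where
  "stirling_error n = ln (fact n) - ((real n + 1 / 2) * ln (real n) - real n)"

lemma stirling_error_diff:
  assumes "n > 0"
  shows "stirling_error n - stirling_error (Suc n) = (real n + 1 / 2) * ln (1 + 1 / real n) - 1"
proof -
  have "ln (1 + 1 / real n) = ln (real (Suc n) / real n)"
    using assms by (simp add: field_simps)
  also have "\<dots> = ln (real (Suc n)) - ln (real n)"
    using assms by (simp add: ln_div)
  finally have 1: "ln (1 + 1 / real n) = ln (real (Suc n)) - ln (real n)" .
  have 2: "ln (fact (Suc n)) = ln (real (Suc n)) + ln (fact n :: real)"
    by (simp add: ln_mult del: of_nat_Suc)
  show ?thesis unfolding stirling_error_def 1 2 by (simp add: algebra_simps)
qed

text \<open>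
  Consecutive differences are of order \<open>1 / n\<^sup>2\<close>, hence summable.
\<close>

lemma convergent_stirling_error: "convergent stirling_error"
proof -
  have "summable (\<lambda>n. (real n + 1 / 2) * ln (1 + 1 / real n) - 1)"
  proof (rule summable_comparison_test_bigo)
    show "(\<lambda>n. (real n + 1 / 2) * ln (1 + 1 / real n) - 1) \<in> O(\<lambda>n. 1 / real n ^ 2)"
      by real_asymp
    show "summable (\<lambda>n. norm (1 / real n ^ 2))"
      using inverse_power_summable[of 2, where 'a = real] by (simp add: field_simps)
  qed
  then have "summable (\<lambda>n. (real (Suc n) + 1 / 2) * ln (1 + 1 / real (Suc n)) - 1)"
    by (subst summable_Suc_iff)
  then have "summable (\<lambda>n. stirling_error (Suc n) - stirling_error (Suc (Suc n)))"
    by (subst stirling_error_diff) simp_all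
  then have "convergent (\<lambda>n. \<Sum>i<n. stirling_error (Suc i) - stirling_error (Suc (Suc i)))"
    by (simp add: summable_iff_convergent)
  then have "convergent (\<lambda>n. stirling_error (Suc 0) - stirling_error (Suc n))"
    unfolding sum_lessThan_telescope'[of "\<lambda>n. stirling_error (Suc n)"] .
  from convergent_diff[OF convergent_const[of "stirling_error (Suc 0)"] this]
  have "convergent (\<lambda>n. stirling_error (Suc n))" by simp
  then show ?thesis by (simp add: convergent_Suc_iff)
qed

text \<open>
  Each factor is \<open>(2 k)\<^sup>2 / ((2 k - 1) (2 k + 1))\<close>, so the product is the square of a quotient of even by odd
  numbers, up to the last factor \<open>2 n + 1\<close>.
\<close>

lemma wallis_prod_eq:
  "(\<Prod>k=1..n. (4 * real k ^ 2) / (4 * real k ^ 2 - 1)) =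
     2 ^ (4 * n) * fact n ^ 4 / (fact (2 * n) ^ 2 * (2 * real n + 1))"
proof (induction n)
  case (Suc n)
  have "(4 * real (Suc n) ^ 2) / (4 * real (Suc n) ^ 2 - 1) =
      (4 * (real n + 1) ^ 2) / ((2 * real n + 1) * (2 * real n + 3))"
    by (simp add: power2_eq_square algebra_simps)
  moreover have "(fact (2 * Suc n) :: real) = 2 * (real n + 1) * (2 * real n + 1) * fact (2 * n)"
    by (simp add: algebra_simps)
  moreover have "(fact (Suc n) :: real) = (real n + 1) * fact n"
    by (simp add: algebra_simps)
  moreover have "E * F ^ 4 / (H ^ 2 * p) * (4 * q ^ 2 / (p * t)) =
      16 * E * (q * F) ^ 4 / ((2 * q * p * H) ^ 2 * t)" if "p > 0" "q > 0" "t > 0" "H > 0"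
    for E F H p q t :: real
    using that by (simp add: divide_simps power2_eq_square power4_eq_xxxx)
  from this[of "2 * real n + 1" "real n + 1" "2 * real n + 3" "fact (2 * n)" "2 ^ (4 * n)" "fact n"]
  have "2 ^ (4 * n) * fact n ^ 4 / (fact (2 * n) ^ 2 * (2 * real n + 1)) *
      (4 * (real n + 1) ^ 2 / ((2 * real n + 1) * (2 * real n + 3))) =
      16 * 2 ^ (4 * n) * ((real n + 1) * fact n) ^ 4 /
        ((2 * (real n + 1) * (2 * real n + 1) * fact (2 * n)) ^ 2 * (2 * real n + 3))"
    by simp
  moreover have "(2 ^ (4 * Suc n) :: real) = 16 * 2 ^ (4 * n)" by (simp add: power_add)
  moreover have "2 * real (Suc n) + 1 = 2 * real n + 3" by simp
  ultimately show ?case using Suc by (simp only: prod.nat_ivl_Suc' prod.atLeast_Suc_atMost_Suc_shift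
        prod.cl_ivl_Suc mult.commute) simp
qed simp

text \<open>
  Stirling's formula. The limit exists by \<open>convergent_stirling_error\<close>, and its value is found by taking
  logarithms in Wallis' product, which is a quotient of factorials of \<open>n\<close> and \<open>2 n\<close>.
\<close>

lemma stirling_error_tendsto: "stirling_error \<longlonglongrightarrow> ln (2 * pi) / 2"
proof -
  from convergent_stirling_error obtain L where L: "stirling_error \<longlonglongrightarrow> L"
    by (auto simp: convergent_def)
  let ?w = "\<lambda>n. \<Prod>k=1..n. (4 * real k ^ 2) / (4 * real k ^ 2 - 1)"
  have ln_w: "ln (?w n) = 4 * stirling_error n - 2 * stirling_error (2 * n)
      + (ln (real n) - ln (2 * real n + 1) - ln 2)" if "n > 0" for n
  proof -
    have "ln (?w n) = 4 * real n * ln 2 + 4 * ln (fact n) - 2 * ln (fact (2 * n)) - ln (2 * real n + 1)"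
      unfolding wallis_prod_eq by (simp add: ln_div ln_mult ln_realpow add_pos_nonneg)
    moreover have "ln (real (2 * n)) = ln 2 + ln (real n)"
      using that by (simp add: ln_mult)
    ultimately show ?thesis
      by (simp add: stirling_error_def algebra_simps)
  qed
  have L2: "(\<lambda>n. stirling_error (2 * n)) \<longlonglongrightarrow> L"
    using LIMSEQ_subseq_LIMSEQ[OF L, of "\<lambda>n. 2 * n"] by (simp add: strict_mono_def o_def)
  have logs: "(\<lambda>n. ln (real n) - ln (2 * real n + 1) - ln 2) \<longlonglongrightarrow> - ln 2 - ln 2"
    by real_asymp
  have "(\<lambda>n. 4 * stirling_error n - 2 * stirling_error (2 * n)
      + (ln (real n) - ln (2 * real n + 1) - ln 2)) \<longlonglongrightarrow> 4 * L - 2 * L + (- ln 2 - ln 2)"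
    by (rule tendsto_add[OF tendsto_diff[OF tendsto_mult_left[OF L] tendsto_mult_left[OF L2]] logs])
  moreover have "(\<lambda>n. ln (?w n)) \<longlonglongrightarrow> ln (pi / 2)"
    by (intro tendsto_ln wallis) simp
  then have "(\<lambda>n. 4 * stirling_error n - 2 * stirling_error (2 * n)
      + (ln (real n) - ln (2 * real n + 1) - ln 2)) \<longlonglongrightarrow> ln (pi / 2)"
    by (rule Lim_transform_eventually)
      (use ln_w in \<open>auto intro: eventually_mono[OF eventually_gt_at_top[of 0]]\<close>)
  ultimately have "4 * L - 2 * L + (- ln 2 - ln 2) = ln (pi / 2)"
    by (rule LIMSEQ_unique)
  then have "L = ln (2 * pi) / 2" by (simp add: ln_div ln_mult)
  with L show ?thesis by simp
qed

text \<open>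
  The exponential rate of the matching probability at \<open>k = n (1/3 + d)\<close>. The constants \<open>ln 2\<close> and \<open>ln 3\<close>
  that Stirling's formula produces cancel identically and have been removed.
\<close>

definition rate :: "real \<Rightarrow> real" where
  "rate d = (4 / 3 + d) * ln (1 + 3 * d / 4) - (1 + 3 * d) * ln (1 + 3 * d) - (1 / 3 - 2 * d) * ln (1 - 6 * d)"

lemma rate_quadratic: "((\<lambda>d. rate d / d ^ 2) \<longlongrightarrow> - 81 / 8) (at 0)"
proof -
  have "((\<lambda>d. rate d / d ^ 2) \<longlongrightarrow> - 81 / 8) (at_right 0)"
    unfolding rate_def by real_asymp
  moreover have "((\<lambda>d. rate d / d ^ 2) \<longlongrightarrow> - 81 / 8) (at_left 0)"
    unfolding rate_def by real_asymp
  ultimately show ?thesis by (simp add: filterlim_split_at)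
qed

text \<open>
  With \<open>y = sqrt n \<cdot> d\<close>, the quantity is \<open>y\<^sup>2 (rate d / d\<^sup>2 + 81/8) - (81/8) (y\<^sup>2 - x\<^sup>2)\<close>, and \<open>y\<close> is bounded.
\<close>

lemma rate_scaled_tendsto:
  fixes d x :: "nat \<Rightarrow> real"
  assumes x: "\<And>n. \<bar>x n\<bar> \<le> A" and y: "(\<lambda>n. sqrt (real n) * d n - x n) \<longlonglongrightarrow> 0"
    and d: "d \<longlonglongrightarrow> 0"
  shows "(\<lambda>n. real n * rate (d n) + 81 / 8 * x n ^ 2) \<longlonglongrightarrow> 0"
proof -
  \<comment> \<open>The removable singularity of \<open>rate t / t\<^sup>2\<close> is filled, so that \<open>d n = 0\<close> needs no separate treatment.\<close>
  define h where "h = (\<lambda>t. if t = 0 then - 81 / 8 else rate t / t ^ 2)"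
  have "(h \<longlongrightarrow> - 81 / 8) (at 0)"
    using rate_quadratic by (rule Lim_transform_eventually)
      (auto simp: h_def eventually_at intro!: exI[of _ 1])
  then have "isCont h 0" by (simp add: isCont_def h_def)
  then have h: "(\<lambda>n. h (d n)) \<longlonglongrightarrow> - 81 / 8"
    using isCont_tendsto_compose[OF _ d, of h] by (simp add: h_def)
  have rate: "rate t = t ^ 2 * h t" for t
    by (simp add: h_def rate_def)
  define y where "y = (\<lambda>n. sqrt (real n) * d n)"
  have yx: "(\<lambda>n. y n - x n) \<longlonglongrightarrow> 0" using assms(2) by (simp add: y_def)
  have bx: "Bfun x sequentially" by (intro BfunI[where K = A]) (use x in auto)
  have "Bfun (\<lambda>n. y n - x n) sequentially"
    using yx by (intro convergent_imp_Bseq) (auto simp: convergent_def)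
  then obtain B where B: "\<And>n. \<bar>y n - x n\<bar> \<le> B" by (auto simp: Bseq_def)
  have by': "\<bar>y n\<bar> \<le> A + B" for n using x[of n] B[of n] by linarith
  have 1: "(\<lambda>n. y n ^ 2 * (h (d n) + 81 / 8)) \<longlonglongrightarrow> 0"
  proof (rule Lim_null_comparison)
    have "(\<lambda>n. \<bar>h (d n) + 81 / 8\<bar>) \<longlonglongrightarrow> \<bar>- 81 / 8 + 81 / 8\<bar>"
      by (intro tendsto_intros h)
    from tendsto_mult_left[OF this, of "(A + B) ^ 2"]
    show "(\<lambda>n. (A + B) ^ 2 * \<bar>h (d n) + 81 / 8\<bar>) \<longlonglongrightarrow> 0" by simp
    have "y n ^ 2 \<le> (A + B) ^ 2" for n
      using power_mono[OF by'[of n], of 2] by simp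
    then show "\<forall>\<^sub>F n in sequentially. norm (y n ^ 2 * (h (d n) + 81 / 8)) \<le> (A + B) ^ 2 * \<bar>h (d n) + 81 / 8\<bar>"
      by (simp add: abs_mult mult_right_mono)
  qed
  have 2: "(\<lambda>n. (y n + x n) * (y n - x n)) \<longlonglongrightarrow> 0"
  proof (rule Lim_null_comparison)
    from tendsto_mult_left[OF tendsto_rabs_zero[OF yx], of "A + B + A"]
    show "(\<lambda>n. (A + B + A) * \<bar>y n - x n\<bar>) \<longlonglongrightarrow> 0" by simp
    have "\<bar>y n + x n\<bar> \<le> A + B + A" for n using by'[of n] x[of n] by linarith
    then show "\<forall>\<^sub>F n in sequentially. norm ((y n + x n) * (y n - x n)) \<le> (A + B + A) * \<bar>y n - x n\<bar>"
      by (simp add: abs_mult mult_right_mono)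
  qed
  have "real n * rate (d n) + 81 / 8 * x n ^ 2 =
      y n ^ 2 * (h (d n) + 81 / 8) - 81 / 8 * ((y n + x n) * (y n - x n))" for n
  proof -
    have yy: "y n ^ 2 = real n * d n ^ 2" by (simp add: y_def power_mult_distrib)
    have diff: "(y n + x n) * (y n - x n) = real n * d n ^ 2 - x n ^ 2"
      unfolding yy[symmetric] by (simp add: algebra_simps power2_eq_square)
    show ?thesis unfolding rate yy diff by (simp add: algebra_simps)
  qed
  moreover have "(\<lambda>n. y n ^ 2 * (h (d n) + 81 / 8) - 81 / 8 * ((y n + x n) * (y n - x n))) \<longlonglongrightarrow> 0 - 81 / 8 * 0"
    by (intro tendsto_intros 1 2)
  ultimately show ?thesis by simp
qed

lemma ln_fact_eq: "ln (fact n) = stirling_error n + ((real n + 1 / 2) * ln (real n) - real n)"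
  by (simp add: stirling_error_def)

text \<open>
  The closed form in \<open>pmf_greedy_size_pmf\<close>; the asymptotic analysis concerns only this expression.
\<close>

definition matching_prob :: "nat \<Rightarrow> nat \<Rightarrow> real" where
  "matching_prob n k = fact n * fact (n - 1) * fact (n + k - 2) /
     (fact k * fact (2 * k - 1) * fact (n - 2 * k) * fact (2 * n - 2))"

text \<open>
  Shifting all arguments of the factorials to \<open>n\<close>, \<open>n + k\<close>, \<open>k\<close>, \<open>2 k\<close>, \<open>n - 2 k\<close> and \<open>2 n\<close> makes the leading terms in
  Stirling's formula cancel exactly; the price is a rational factor tending to \<open>3/2\<close>.
\<close>

lemma matching_prob_eq:
  assumes "1 \<le> k" "2 * k \<le> n"
  shows "matching_prob n k = fact n ^ 2 * fact (n + k) / (fact k * fact (2 * k) * fact (n - 2 * k) * fact (2 * n))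
     * (4 * real k * (2 * real n - 1) / ((real n + real k) * (real n + real k - 1)))"
proof -
  have 1: "(fact n :: real) = real n * fact (n - 1)"
    using assms by (simp add: fact_reduce)
  have fact2: "(fact m :: real) = real m * (real m - 1) * fact (m - 2)" if m: "m \<ge> 2" for m
  proof -
    obtain j where "m = Suc (Suc j)" using m by (metis Suc_le_D numeral_2_eq_2 Suc_le_mono)
    then show ?thesis by (simp add: algebra_simps)
  qed
  have 2: "(fact (n + k) :: real) = (real n + real k) * (real n + real k - 1) * fact (n + k - 2)"
    using fact2[of "n + k"] assms by simp
  have 3: "(fact (2 * k) :: real) = 2 * real k * fact (2 * k - 1)"
    using assms by (simp add: fact_reduce)
  have 4: "(fact (2 * n) :: real) = 2 * real n * (2 * real n - 1) * fact (2 * n - 2)"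
    using fact2[of "2 * n"] assms by simp
  have pos: "real n > 0" "real k > 0" "2 * real n - 1 > 0" "real n + real k > 0" "real n + real k - 1 > 0"
    using assms by linarith+
  show ?thesis unfolding matching_prob_def 2 3 4 power2_eq_square
    unfolding 1 using pos by (simp add: divide_simps)
qed

text \<open>
  An exact identity: the arguments of the logarithms are \<open>n + k = (4/3) n (1 + 3 d / 4)\<close>,
  \<open>k = n (1 + 3 d) / 3\<close> and \<open>n - 2 k = n (1 - 6 d) / 3\<close>.
\<close>

lemma ln_matching_prob:
  fixes d :: real
  assumes "1 \<le> k" "2 * k < n" and d: "d = real k / real n - 1 / 3"
  shows "ln (matching_prob n k) =
     2 * stirling_error n + stirling_error (n + k) - stirling_error k - stirling_error (2 * k)
       - stirling_error (n - 2 * k) - stirling_error (2 * n)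
     + real n * rate d - ln (real n) / 2 + ln 3
     + (ln (1 + 3 * d / 4) / 2 - ln (1 + 3 * d) - ln (1 - 6 * d) / 2)
     + ln (4 * real k * (2 * real n - 1) / ((real n + real k) * (real n + real k - 1)))"
proof -
  let ?q = "4 * real k * (2 * real n - 1) / ((real n + real k) * (real n + real k - 1))"
  have pos: "real n > 0" "real k > 0" using assms by simp_all
  have q: "?q > 0" using assms by (intro divide_pos_pos mult_pos_pos) auto
  have k: "real k = real n * (1 / 3 + d)" using d pos by (simp add: field_simps)
  have "1 + 3 * d = 3 * real k / real n" by (simp add: d)
  then have u: "1 + 3 * d > 0" using pos by simp
  have "1 - 6 * d = 3 * (real n - 2 * real k) / real n"
    using pos by (simp add: d field_simps)
  then have v: "1 - 6 * d > 0" using pos assms(2) by simp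
  have w: "1 + 3 * d / 4 > 0" using u by simp
  have l1: "ln (real (n + k)) = ln (real n) + 2 * ln 2 - ln 3 + ln (1 + 3 * d / 4)"
  proof -
    have "real (n + k) = real n * 4 * (1 + 3 * d / 4) / 3" by (simp add: k algebra_simps)
    moreover have "ln (4 :: real) = 2 * ln 2" using ln_realpow[of 2 2] by simp
    ultimately show ?thesis using pos w by (simp only: ln_mult ln_div) simp
  qed
  have l2: "ln (real k) = ln (real n) - ln 3 + ln (1 + 3 * d)"
  proof -
    have "real k = real n * (1 + 3 * d) / 3" by (simp add: k algebra_simps)
    then show ?thesis using pos u by (simp only: ln_mult ln_div) simp
  qed
  have l3: "ln (real (2 * k)) = ln (real n) + ln 2 - ln 3 + ln (1 + 3 * d)"
    using l2 pos by (simp add: ln_mult)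
  have l4: "ln (real (n - 2 * k)) = ln (real n) - ln 3 + ln (1 - 6 * d)"
  proof -
    have "real (n - 2 * k) = real n * (1 - 6 * d) / 3"
      using assms(2) by (simp add: of_nat_diff k algebra_simps)
    then show ?thesis using pos v by (simp only: ln_mult ln_div) simp
  qed
  have l5: "ln (real (2 * n)) = ln (real n) + ln 2" using pos by (simp add: ln_mult)
  have "ln (matching_prob n k) = 2 * ln (fact n) + ln (fact (n + k)) - ln (fact k) - ln (fact (2 * k))
      - ln (fact (n - 2 * k)) - ln (fact (2 * n)) + ln ?q"
    using assms q by (simp add: matching_prob_eq ln_mult ln_div ln_realpow)
  moreover have "real (n - 2 * k) = real n - 2 * real k" using assms(2) by (simp add: of_nat_diff)
  ultimately show ?thesis
    unfolding ln_fact_eq l1 l2 l3 l4 l5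
    by (simp add: rate_def k) (simp add: algebra_simps)
qed

section \<open>The local limit\<close>

text \<open>
  If convergence were not uniform, points \<open>x n\<close> that violate the bound could be chosen for infinitely many
  \<open>n\<close>, and convergence along this sequence would fail.
\<close>

lemma uniform_limit_sequentiallyI:
  assumes "\<And>x. (\<And>n. x n \<in> S) \<Longrightarrow> (\<lambda>n. dist (f n (x n)) (l (x n))) \<longlonglongrightarrow> 0"
  shows "uniform_limit S f l sequentially"
proof (cases "S = {}")
  case False
  then obtain s where s: "s \<in> S" by blast
  show ?thesis
  proof (rule uniform_limitI)
    fix e :: real assume e: "e > 0"
    define x where "x = (\<lambda>n. if \<exists>x\<in>S. dist (f n x) (l x) \<ge> e
        then SOME x. x \<in> S \<and> dist (f n x) (l x) \<ge> e else s)"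
    have x: "x n \<in> S" "\<exists>x\<in>S. dist (f n x) (l x) \<ge> e \<Longrightarrow> dist (f n (x n)) (l (x n)) \<ge> e" for n
      using someI_ex[of "\<lambda>x. x \<in> S \<and> dist (f n x) (l x) \<ge> e"] s by (auto simp: x_def)
    have "\<forall>\<^sub>F n in sequentially. dist (f n (x n)) (l (x n)) < e"
      using assms[of x] x(1) e by (intro order_tendstoD) auto
    then show "\<forall>\<^sub>F n in sequentially. \<forall>x\<in>S. dist (f n x) (l x) < e"
      by eventually_elim (use x(2) in \<open>force simp: not_less\<close>)
  qed
qed simp

definition gauss_density :: "real \<Rightarrow> real" where
  "gauss_density x = 1 / sqrt (2 * pi * (2 / 9)\<^sup>2) * exp (- (x\<^sup>2 / (2 * (2 / 9)\<^sup>2)))"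

text \<open>
  The limit along an arbitrary sequence of integers at bounded distance from \<open>n/3\<close> on the scale \<open>sqrt n\<close>.
  The exponent \<open>E\<close> collects the terms of \<open>ln_matching_prob\<close> and the logarithm of the density. Of the
  Stirling constants, \<open>- ln (2 pi) / 2\<close> survives; together with \<open>ln 3\<close> and the limit \<open>ln (3/2)\<close> of the rational
  factor it cancels against the normalisation \<open>sqrt (2 pi) \<cdot> 2/9\<close>.
\<close>

lemma local_limit:
  fixes k :: "nat \<Rightarrow> nat" and x :: "nat \<Rightarrow> real"
  assumes x: "\<And>n. \<bar>x n\<bar> \<le> A"
    and k: "(\<lambda>n. (real (k n) - real n / 3) / sqrt (real n) - x n) \<longlonglongrightarrow> 0"
  shows "(\<lambda>n. matching_prob n (k n) / (1 / sqrt (real n) * gauss_density (x n))) \<longlonglongrightarrow> 1"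
    and "\<forall>\<^sub>F n in sequentially. 1 \<le> k n \<and> 2 * k n < n"
proof -
  define d where "d = (\<lambda>n. real (k n) / real n - 1 / 3)"
  have scaled: "sqrt (real n) * d n = (real (k n) - real n / 3) / sqrt (real n)" for n
  proof (cases "n = 0")
    case False
    then have "d n = (real (k n) - real n / 3) / real n" by (simp add: d_def field_simps)
    then have "sqrt (real n) * d n = (real (k n) - real n / 3) * (sqrt (real n) / real n)" by simp
    also have "sqrt (real n) / real n = inverse (sqrt (real n))"
      by (rule sqrt_divide_self_eq) simp
    finally show ?thesis by (simp only: divide_inverse)
  qed (simp add: d_def)
  have y: "(\<lambda>n. sqrt (real n) * d n - x n) \<longlonglongrightarrow> 0" using k by (simp only: scaled)
  have d: "d \<longlonglongrightarrow> 0"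
  proof -
    have "(\<lambda>n. x n * (1 / sqrt (real n))) \<longlonglongrightarrow> 0"
    proof (rule Lim_null_comparison)
      show "(\<lambda>n. A * (1 / sqrt (real n))) \<longlonglongrightarrow> 0" by real_asymp
      show "\<forall>\<^sub>F n in sequentially. norm (x n * (1 / sqrt (real n))) \<le> A * (1 / sqrt (real n))"
        by (intro always_eventually allI) (simp add: abs_mult x divide_right_mono)
    qed
    moreover have "(\<lambda>n. (sqrt (real n) * d n - x n) * (1 / sqrt (real n))) \<longlonglongrightarrow> 0 * 0"
      by (intro tendsto_mult y) real_asymp
    ultimately have "(\<lambda>n. (sqrt (real n) * d n - x n) * (1 / sqrt (real n)) + x n * (1 / sqrt (real n))) \<longlonglongrightarrow> 0 * 0 + 0"
      by (intro tendsto_add)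
    then have "(\<lambda>n. (sqrt (real n) * d n - x n) * (1 / sqrt (real n)) + x n * (1 / sqrt (real n))) \<longlonglongrightarrow> 0"
      by simp
    then show ?thesis
      by (rule Lim_transform_eventually)
        (auto intro!: eventually_mono[OF eventually_gt_at_top[of 0]] simp: field_simps)
  qed
  have kd: "real (k n) = real n * (1 / 3 + d n)" if "n > 0" for n
    using that by (simp add: d_def field_simps)
  \<comment> \<open>With \<open>d\<close> within \<open>1/12\<close> of 0, \<open>k\<close> lies between \<open>n/4\<close> and \<open>5 n / 12\<close>, away from both ends of its range.\<close>
  have small: "\<forall>\<^sub>F n in sequentially. n > 0 \<and> \<bar>d n\<bar> < 1 / 12"
    using eventually_gt_at_top[of "0 :: nat"] tendstoD[OF d, of "1 / 12"]
    by (auto simp: eventually_conj_iff)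
  have range: "\<forall>\<^sub>F n in sequentially. real n / 4 \<le> real (k n) \<and> real n / 4 \<le> real (n + k n)
      \<and> real n / 4 \<le> real (2 * k n) \<and> real n / 6 \<le> real (n - 2 * k n) \<and> 1 \<le> k n \<and> 2 * k n < n"
    using small
  proof eventually_elim
    case (elim n)
    then have n: "real n > 0" by simp
    have lo: "real n * (1 / 4) \<le> real (k n)"
      unfolding kd[OF conjunct1[OF elim]] using elim by (intro mult_left_mono) auto
    have hi: "real (k n) \<le> real n * (5 / 12)"
      unfolding kd[OF conjunct1[OF elim]] using elim by (intro mult_left_mono) auto
    have "real (k n) > 0" using lo n by linarith
    moreover have "2 * k n < n" using hi n by linarith
    ultimately show ?case using lo hi by (auto simp: of_nat_diff)
  qed
  then show "\<forall>\<^sub>F n in sequentially. 1 \<le> k n \<and> 2 * k n < n"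
    by eventually_elim simp
  have quarter: "filterlim (\<lambda>n. real n / 4) at_top sequentially" by real_asymp
  have sixth: "filterlim (\<lambda>n. real n / 6) at_top sequentially" by real_asymp
  have se: "(\<lambda>n. stirling_error (f n)) \<longlonglongrightarrow> ln (2 * pi) / 2"
    if "filterlim (\<lambda>n. real (f n)) at_top sequentially" for f :: "nat \<Rightarrow> nat"
    by (rule filterlim_compose[OF stirling_error_tendsto])
      (use that in \<open>simp add: filterlim_sequentially_iff_filterlim_real\<close>)
  have s1: "(\<lambda>n. stirling_error (k n)) \<longlonglongrightarrow> ln (2 * pi) / 2"
    by (intro se filterlim_at_top_mono[OF quarter] eventually_mono[OF range]) blast
  have s2: "(\<lambda>n. stirling_error (n + k n)) \<longlonglongrightarrow> ln (2 * pi) / 2"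
    by (intro se filterlim_at_top_mono[OF quarter] eventually_mono[OF range]) blast
  have s3: "(\<lambda>n. stirling_error (2 * k n)) \<longlonglongrightarrow> ln (2 * pi) / 2"
    by (intro se filterlim_at_top_mono[OF quarter] eventually_mono[OF range]) blast
  have s4: "(\<lambda>n. stirling_error (n - 2 * k n)) \<longlonglongrightarrow> ln (2 * pi) / 2"
    by (intro se filterlim_at_top_mono[OF sixth] eventually_mono[OF range]) blast
  have s5: "(\<lambda>n. stirling_error (2 * n)) \<longlonglongrightarrow> ln (2 * pi) / 2"
    by (intro se) real_asymp
  \<comment> \<open>The rational factor of \<open>matching_prob_eq\<close>, expressed in \<open>d\<close> and divided through by \<open>n\<^sup>2\<close>.\<close>
  define q where "q = (\<lambda>n. 4 * (1 / 3 + d n) * (2 - 1 / real n) / ((4 / 3 + d n) * (4 / 3 + d n - 1 / real n)))"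
  have inv: "(\<lambda>n. 1 / real n) \<longlonglongrightarrow> 0" by real_asymp
  have "q \<longlonglongrightarrow> 4 * (1 / 3 + 0) * (2 - 0) / ((4 / 3 + 0) * (4 / 3 + 0 - 0))"
    unfolding q_def by (intro tendsto_intros d inv) simp
  then have "(\<lambda>n. ln (q n)) \<longlonglongrightarrow> ln (3 / 2)"
    by (intro tendsto_ln) simp_all
  then have lq: "(\<lambda>n. ln (q n)) \<longlonglongrightarrow> ln 3 - ln 2" by (simp add: ln_div)
  have "(\<lambda>n. ln (1 + 3 * d n / 4) / 2 - ln (1 + 3 * d n) - ln (1 - 6 * d n) / 2) \<longlonglongrightarrow>
      ln (1 + 3 * 0 / 4) / 2 - ln (1 + 3 * 0) - ln (1 - 6 * 0) / 2"
    by (intro tendsto_intros d) simp_all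
  then have corr: "(\<lambda>n. ln (1 + 3 * d n / 4) / 2 - ln (1 + 3 * d n) - ln (1 - 6 * d n) / 2) \<longlonglongrightarrow> 0"
    by simp
  define E where "E = (\<lambda>n. 2 * stirling_error n + stirling_error (n + k n) - stirling_error (k n)
      - stirling_error (2 * k n) - stirling_error (n - 2 * k n) - stirling_error (2 * n)
      + (real n * rate (d n) + 81 / 8 * x n ^ 2) + ln 3
      + (ln (1 + 3 * d n / 4) / 2 - ln (1 + 3 * d n) - ln (1 - 6 * d n) / 2) + ln (q n)
      + (ln (2 * pi) / 2 + ln 2 - 2 * ln 3))"
  define c where "c = ln (2 * pi) / 2"
  have "E \<longlonglongrightarrow> 2 * c + c - c - c - c - c + 0 + ln 3 + 0 + (ln 3 - ln 2) + (c + ln 2 - 2 * ln 3)"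
    unfolding E_def c_def
    by (intro tendsto_add tendsto_diff tendsto_mult_left tendsto_const stirling_error_tendsto s1 s2 s3 s4 s5
        rate_scaled_tendsto[OF x y d] corr lq)
  then have "(\<lambda>n. exp (E n)) \<longlonglongrightarrow> exp 0" by (intro tendsto_exp) simp
  then have "(\<lambda>n. exp (E n)) \<longlonglongrightarrow> 1" by simp
  then show "(\<lambda>n. matching_prob n (k n) / (1 / sqrt (real n) * gauss_density (x n))) \<longlonglongrightarrow> 1"
  proof (rule Lim_transform_eventually)
    show "\<forall>\<^sub>F n in sequentially. exp (E n) =
        matching_prob n (k n) / (1 / sqrt (real n) * gauss_density (x n))"
      using range small
    proof eventually_elim
      case (elim n)
      then have n: "real n > 0" and kn: "1 \<le> k n" "2 * k n < n" by auto
      have pos: "matching_prob n (k n) > 0" by (simp add: matching_prob_def)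
      have "1 / sqrt (real n) = exp (- ln (real n) / 2)"
        using n by (simp add: exp_minus ln_sqrt[symmetric] inverse_eq_divide)
      moreover have "1 / sqrt (2 * pi * (2 / 9)\<^sup>2) = exp (- (ln (2 * pi) / 2 + ln 2 - 2 * ln 3))"
      proof -
        have "ln (9 :: real) = 2 * ln 3" using ln_realpow[of 3 2] by simp
        then have "ln (2 * pi) / 2 + ln 2 - 2 * ln 3 = ln (sqrt (2 * pi) * (2 / 9))"
          by (simp add: ln_mult ln_div ln_sqrt)
        then have "exp (- (ln (2 * pi) / 2 + ln 2 - 2 * ln 3)) = 1 / (sqrt (2 * pi) * (2 / 9))"
          by (simp only: exp_minus) (simp add: inverse_eq_divide)
        then show ?thesis by (simp add: real_sqrt_mult)
      qed
      moreover have "exp (- ((x n)\<^sup>2 / (2 * (2 / 9)\<^sup>2))) = exp (- (81 / 8 * x n ^ 2))"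
        by (simp add: power2_eq_square)
      ultimately have "1 / sqrt (real n) * gauss_density (x n) =
          exp (- ln (real n) / 2 - (ln (2 * pi) / 2 + ln 2 - 2 * ln 3) - 81 / 8 * x n ^ 2)"
        unfolding gauss_density_def by (simp only: mult_exp_exp) (simp add: algebra_simps)
      moreover have "4 * real (k n) * (2 * real n - 1) / ((real n + real (k n)) * (real n + real (k n) - 1)) = q n"
      proof -
        have "4 * real (k n) * (2 * real n - 1) = real n ^ 2 * (4 * (1 / 3 + d n) * (2 - 1 / real n))"
          unfolding kd[OF conjunct1[OF elim(2)]] using n by (simp add: field_simps power2_eq_square)
        moreover have "(real n + real (k n)) * (real n + real (k n) - 1) =
            real n ^ 2 * ((4 / 3 + d n) * (4 / 3 + d n - 1 / real n))"
          unfolding kd[OF conjunct1[OF elim(2)]] using n by (simp add: field_simps power2_eq_square)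
        ultimately show ?thesis using n by (simp add: q_def)
      qed
      then have "matching_prob n (k n) = exp (E n - (ln (2 * pi) / 2 + ln 2 - 2 * ln 3)
          - 81 / 8 * x n ^ 2 - ln (real n) / 2)"
        using ln_matching_prob[OF kn fun_cong[OF d_def]] pos
        by (subst exp_ln[OF pos, symmetric]) (simp add: E_def)
      ultimately show ?case by (simp add: exp_diff[symmetric])
    qed
  qed
qed

section \<open>The law of the greedy matching and its Gaussian limit\<close>

theorem theorem3:
  shows "(\<forall>n k :: nat. 2 \<le> n \<and> 1 \<le> k \<and> k \<le> n div 2 \<longrightarrow>
            pmf (greedy_size_pmf n) k =
              real n / real k * (real ((n + k - 2) choose (2 * k - 1)) * real ((n - k - 1) choose (k - 1)))
                / real ((2 * n - 2) choose (n - 1)) \<and>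
            pmf (greedy_size_pmf n) k =
              (fact n * fact (n - 1) * fact (n + k - 2))
                / (fact k * fact (2 * k - 1) * fact (n - 2 * k) * fact (2 * n - 2)))
       \<and> (\<forall>A :: real. 0 \<le> A \<longrightarrow>
            uniform_limit {-A..A}
              (\<lambda>n x. measure_pmf.prob (greedy_size_pmf n)
                        {k. int k = \<lfloor>real n / 3 + x * sqrt (real n)\<rfloor>}
                     / (1 / sqrt (real n) * (1 / sqrt (2 * pi * (2 / 9)\<^sup>2))
                         * exp (- (x\<^sup>2 / (2 * (2 / 9)\<^sup>2)))))
              (\<lambda>x. 1) sequentially)"
proof (rule conjI; intro allI impI)
  fix n k :: nat assume "2 \<le> n \<and> 1 \<le> k \<and> k \<le> n div 2"
  then have "2 \<le> n" "1 \<le> k" "k \<le> n div 2" by simp_all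
  from pmf_greedy_size_pmf_binomial[OF this] pmf_greedy_size_pmf[OF this]
  show "pmf (greedy_size_pmf n) k =
              real n / real k * (real ((n + k - 2) choose (2 * k - 1)) * real ((n - k - 1) choose (k - 1)))
                / real ((2 * n - 2) choose (n - 1)) \<and>
            pmf (greedy_size_pmf n) k =
              (fact n * fact (n - 1) * fact (n + k - 2))
                / (fact k * fact (2 * k - 1) * fact (n - 2 * k) * fact (2 * n - 2))"
    by (rule conjI)
next
  fix A :: real
  let ?f = "\<lambda>n x. \<lfloor>real n / 3 + x * sqrt (real n)\<rfloor>"
  let ?p = "\<lambda>n x. measure_pmf.prob (greedy_size_pmf n) {k. int k = ?f n x}"
  show "uniform_limit {-A..A} (\<lambda>n x. ?p n x / (1 / sqrt (real n) * (1 / sqrt (2 * pi * (2 / 9)\<^sup>2))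
      * exp (- (x\<^sup>2 / (2 * (2 / 9)\<^sup>2))))) (\<lambda>x. 1) sequentially"
  proof (rule uniform_limit_sequentiallyI)
    fix x :: "nat \<Rightarrow> real" assume mem: "\<And>n. x n \<in> {-A..A}"
    have x: "\<bar>x n\<bar> \<le> A" for n using mem[of n] by (simp add: abs_le_iff)
    define k where "k = (\<lambda>n. nat (?f n (x n)))"
    \<comment> \<open>The conversion \<open>nat\<close> is harmless once the floor is nonnegative, which holds when \<open>A sqrt n \<le> n / 3\<close>.\<close>
    have "\<forall>\<^sub>F n :: nat in sequentially. 0 < real n \<and> 0 \<le> real n / 3 - A * sqrt (real n)"
      by (intro eventually_conj; real_asymp)
    then have floor: "\<forall>\<^sub>F n in sequentially. 0 < real n \<and> int (k n) = ?f n (x n)"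
    proof eventually_elim
      case (elim n)
      have "- (x n) * sqrt (real n) \<le> A * sqrt (real n)"
        using x[of n] by (intro mult_right_mono) auto
      with elim have "0 \<le> real n / 3 + x n * sqrt (real n)" by simp
      then have "0 \<le> ?f n (x n)" by simp
      with elim show ?case by (simp add: k_def)
    qed
    have near: "(\<lambda>n. (real (k n) - real n / 3) / sqrt (real n) - x n) \<longlonglongrightarrow> 0"
    proof (rule Lim_null_comparison)
      show "(\<lambda>n. 1 / sqrt (real n)) \<longlonglongrightarrow> 0" by real_asymp
      show "\<forall>\<^sub>F n in sequentially. norm ((real (k n) - real n / 3) / sqrt (real n) - x n) \<le> 1 / sqrt (real n)"
        using floor
      proof eventually_elim
        case (elim n)
        then have "real (k n) = of_int (?f n (x n))" by (metis of_int_of_nat_eq)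
        then have "\<bar>real (k n) - real n / 3 - x n * sqrt (real n)\<bar> \<le> 1" by linarith
        then have "\<bar>real (k n) - real n / 3 - x n * sqrt (real n)\<bar> / sqrt (real n) \<le> 1 / sqrt (real n)"
          by (intro divide_right_mono) simp_all
        moreover have "(real (k n) - real n / 3) / sqrt (real n) - x n =
            (real (k n) - real n / 3 - x n * sqrt (real n)) / sqrt (real n)"
          using elim by (simp add: diff_divide_distrib)
        ultimately show ?case by (simp add: abs_divide)
      qed
    qed
    have "(\<lambda>n. ?p n (x n) / (1 / sqrt (real n) * (1 / sqrt (2 * pi * (2 / 9)\<^sup>2))
        * exp (- ((x n)\<^sup>2 / (2 * (2 / 9)\<^sup>2))))) \<longlonglongrightarrow> 1"
    proof (rule Lim_transform_eventually[OF local_limit(1)[OF x near]])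
      show "\<forall>\<^sub>F n in sequentially. matching_prob n (k n) / (1 / sqrt (real n) * gauss_density (x n)) =
          ?p n (x n) / (1 / sqrt (real n) * (1 / sqrt (2 * pi * (2 / 9)\<^sup>2))
            * exp (- ((x n)\<^sup>2 / (2 * (2 / 9)\<^sup>2))))"
        using floor local_limit(2)[OF x near]
      proof eventually_elim
        case (elim n)
        have "{j. int j = ?f n (x n)} = {k n}" using elim by auto
        then have "?p n (x n) = pmf (greedy_size_pmf n) (k n)" by (simp add: pmf.rep_eq)
        also have "\<dots> = matching_prob n (k n)"
          unfolding matching_prob_def by (rule pmf_greedy_size_pmf) (use elim in auto)
        finally show ?case by (simp add: gauss_density_def mult.assoc)
      qed
    qed
    from tendsto_dist[OF this tendsto_const[of 1]]
    show "(\<lambda>n. dist (?p n (x n) / (1 / sqrt (real n) * (1 / sqrt (2 * pi * (2 / 9)\<^sup>2))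
        * exp (- ((x n)\<^sup>2 / (2 * (2 / 9)\<^sup>2))))) 1) \<longlonglongrightarrow> 0" by simp
  qed
qed

end
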